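(* Let $\rho:\Gamma\to\mathrm{GL}_3(\mathbb{C})$ be an indecomposable representation with $\rho(T)$ diagonalizable that has a one-dimensional subrepresentation $\rho_0$, so that there is an exact sequence $0\to\rho_0\to\rho\to\rho_1\to 0$ with $\rho_1$ two-dimensional. Then $\rho$ is equivalent to one of the representations in the list $\mathcal{L}$ below if and only if $\rho$ admits a two-dimensional invariant subspace. Otherwise, $\rho_1$ is irreducible and $\rho$ is equivalent to the dual $\rho'^{*}$ (where $\rho'^*(\gamma)=\rho'(\gamma^{-1})^t$) of an indecomposable representation $\rho':\Gamma\to\mathrm{GL}_3(\mathbb{C})$ with $\rho'(T)$ diagonalizable that contains an irreducible two-dimensional subrepresentation $\rho_0'$ for which the ratio of the two eigenvalues of $\rho_0'(T)$ is different from $-1$. The list $\mathcal{L}$ consists of the following 24 representations, each with $\rho(T)=\mathrm{diag}(\lambda_1,\lambda_2,\lambda_3)$, $\lambda_j=e(x_j/6)$: (a) $\rho(S)=\begin{pmatrix}-\sigma&0&1\\0&-\sigma&1\\0&0&\sigma\end{pmatrix}$, $\sigma=\lambda_3^3$, $(x_1,x_2,x_3)\in\{(1,5,0),(2,0,1),(3,1,2),(4,2,3),(5,3,4),(0,4,5)\}$; (b) $\rho(S)=\begin{pmatrix}-\sigma&1&1\\0&\sigma&0\\0&0&\sigma\end{pmatrix}$, $\sigma=\lambda_2^3$, $(x_1,x_2,x_3)\in\{(1,2,0),(5,4,0),(2,3,1),(0,5,1),(3,4,2),(4,5,3)\}$; (c) $\rho(S)=\begin{pmatrix}\sigma&-2\sigma&1\\0&-\sigma&1\\0&0&\sigma\end{pmatrix}$,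 $\sigma=\lambda_1^3$, $(x_1,x_2,x_3)\in\{(5,0,1),(1,0,5),(0,1,2),(2,1,0),(1,2,3),(3,2,1),(2,3,4),(4,3,2),(3,4,5),(5,4,3),(4,5,0),(0,5,4)\}$.
   Context: $\Gamma=\mathrm{PSL}_2(\mathbb{Z})$, and $S,T$ denote the images in $\Gamma$ of $\begin{pmatrix}0&-1\\1&0\end{pmatrix}$ and $\begin{pmatrix}1&1\\0&1\end{pmatrix}$; a matrix representation of $\Gamma$ is determined by matrices $\rho(S),\rho(T)$ with $\rho(S)^2=\rho(ST)^3=1$. For $r\in\mathbb{R}$, $e(r)=e^{2\pi i r}$. Equivalence means conjugacy by an invertible matrix. *)

theory Defs
  imports "HOL-Analysis.Analysis" "HOL-Algebra.Coset"
begin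

definition SL2Z :: "(int^2^2) monoid" where
  "SL2Z = \<lparr>carrier = {A. det A = 1}, mult = (**), one = mat 1\<rparr>"

definition PSL2Z :: "(int^2^2) set monoid" where
  "PSL2Z = SL2Z Mod {mat 1, - mat 1}"

text \<open>The image in \<open>\<Gamma>\<close> of a matrix is its coset modulo \<open>\<plusminus>1\<close>.\<close>

definition PSL2Z_image :: "int^2^2 \<Rightarrow> (int^2^2) set" where
  "PSL2Z_image A = {mat 1, - mat 1} #>\<^bsub>SL2Z\<^esub> A"

definition S\<^sub>\<Gamma> :: "(int^2^2) set" where
  "S\<^sub>\<Gamma> = PSL2Z_image (vector [vector [0, -1], vector [1, 0]])"

definition T\<^sub>\<Gamma> :: "(int^2^2) set" where
  "T\<^sub>\<Gamma> = PSL2Z_image (vector [vector [1, 1], vector [0, 1]])"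

definition GL :: "(complex^'n^'n) monoid" where
  "GL = \<lparr>carrier = {A. invertible A}, mult = (**), one = mat 1\<rparr>"

text \<open>A representation is a function on all sets of integer matrices of which only
  the values on \<open>carrier PSL2Z\<close> matter; the notions below look only at those values.\<close>

type_synonym 'n rep = "(int^2^2) set \<Rightarrow> complex^'n^'n"

definition matrix_rep :: "'n::finite rep \<Rightarrow> bool" where
  "matrix_rep \<rho> \<longleftrightarrow> \<rho> \<in> hom PSL2Z GL"

definition equivalent :: "'n::finite rep \<Rightarrow> 'n rep \<Rightarrow> bool" where
  "equivalent \<rho> \<rho>' \<longleftrightarrow>
     (\<exists>P :: complex^'n^'n. invertible P \<and> (\<forall>\<gamma>\<in>carrier PSL2Z. \<rho>' \<gamma> = P ** \<rho> \<gamma> ** matrix_inv P))"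

definition dual :: "'n::finite rep \<Rightarrow> 'n rep" where
  "dual \<rho> = (\<lambda>\<gamma>. transpose (\<rho> (inv\<^bsub>PSL2Z\<^esub> \<gamma>)))"

text \<open>Here \<open>vec.subspace\<close> and \<open>vec.dim\<close> are taken over the complex field,
  unlike the real notions \<open>subspace\<close> and \<open>dim\<close>.\<close>

definition invariant_subspace :: "'n::finite rep \<Rightarrow> (complex^'n) set \<Rightarrow> bool" where
  "invariant_subspace \<rho> W \<longleftrightarrow>
     vec.subspace W \<and> (\<forall>\<gamma>\<in>carrier PSL2Z. \<forall>v\<in>W. \<rho> \<gamma> *v v \<in> W)"

text \<open>The space \<open>complex^'n\<close> is never zero, because index types are nonempty.\<close>

definition irreducible_rep :: "'n::finite rep \<Rightarrow> bool" where
  "irreducible_rep \<rho> \<longleftrightarrow> (\<forall>W. invariant_subspace \<rho> W \<longrightarrow> W = {0} \<or> W = UNIV)"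

definition indecomposable :: "'n::finite rep \<Rightarrow> bool" where
  "indecomposable \<rho> \<longleftrightarrow>
     \<not> (\<exists>U W. invariant_subspace \<rho> U \<and> invariant_subspace \<rho> W \<and>
          U \<noteq> {0} \<and> W \<noteq> {0} \<and> U \<inter> W = {0} \<and> (\<forall>v. \<exists>u\<in>U. \<exists>w\<in>W. v = u + w))"

definition intertwines :: "'m::finite rep \<Rightarrow> complex^'m^'n \<Rightarrow> 'n::finite rep \<Rightarrow> bool" where
  "intertwines \<rho> M \<rho>' \<longleftrightarrow> (\<forall>\<gamma>\<in>carrier PSL2Z. M ** \<rho> \<gamma> = \<rho>' \<gamma> ** M)"

definition subrepresentation_via ::
  "'m::finite rep \<Rightarrow> complex^'m^'n \<Rightarrow> 'n::finite rep \<Rightarrow> bool" where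
  "subrepresentation_via \<rho>\<^sub>0 J \<rho> \<longleftrightarrow>
     matrix_rep \<rho>\<^sub>0 \<and> matrix_rep \<rho> \<and> intertwines \<rho>\<^sub>0 J \<rho> \<and> inj ((*v) J)"

text \<open>\<open>0 \<rightarrow> \<rho>\<^sub>0 \<rightarrow> \<rho> \<rightarrow> \<rho>\<^sub>1 \<rightarrow> 0\<close> is exact, with maps given by the matrices \<open>J\<close> and \<open>Q\<close>.\<close>

definition short_exact ::
  "'m::finite rep \<Rightarrow> complex^'m^'n \<Rightarrow> 'n::finite rep \<Rightarrow> complex^'n^'k \<Rightarrow> 'k::finite rep \<Rightarrow> bool" where
  "short_exact \<rho>\<^sub>0 J \<rho> Q \<rho>\<^sub>1 \<longleftrightarrow>
     subrepresentation_via \<rho>\<^sub>0 J \<rho> \<and> matrix_rep \<rho>\<^sub>1 \<and> intertwines \<rho> Q \<rho>\<^sub>1 \<and>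
     surj ((*v) Q) \<and> range ((*v) J) = {v. Q *v v = 0}"

text \<open>The type annotations are needed: \<open>invertible\<close> also accepts rectangular matrices.\<close>

definition diagonalizable :: "complex^'n^'n \<Rightarrow> bool" where
  "diagonalizable A \<longleftrightarrow>
     (\<exists>(P :: complex^'n^'n) (D :: complex^'n^'n). invertible P \<and> (\<forall>i j. i \<noteq> j \<longrightarrow> D $ i $ j = 0) \<and>
        A = P ** D ** matrix_inv P)"

definition eigenvalue :: "complex^'n^'n \<Rightarrow> complex \<Rightarrow> bool" where
  "eigenvalue A \<mu> \<longleftrightarrow> (\<exists>v. v \<noteq> 0 \<and> A *v v = \<mu> *s v)"

definition e_of :: "real \<Rightarrow> complex" where
  "e_of r = exp (2 * of_real pi * \<i> * of_real r)"

definition lam :: "nat \<Rightarrow> complex" where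
  "lam x = e_of (real x / 6)"

definition diag3 :: "complex \<Rightarrow> complex \<Rightarrow> complex \<Rightarrow> complex^3^3" where
  "diag3 a b c = vector [vector [a, 0, 0], vector [0, b, 0], vector [0, 0, c]]"

definition S_a :: "complex \<Rightarrow> complex^3^3" where
  "S_a \<sigma> = vector [vector [-\<sigma>, 0, 1], vector [0, -\<sigma>, 1], vector [0, 0, \<sigma>]]"

definition S_b :: "complex \<Rightarrow> complex^3^3" where
  "S_b \<sigma> = vector [vector [-\<sigma>, 1, 1], vector [0, \<sigma>, 0], vector [0, 0, \<sigma>]]"

definition S_c :: "complex \<Rightarrow> complex^3^3" where
  "S_c \<sigma> = vector [vector [\<sigma>, -2 * \<sigma>, 1], vector [0, -\<sigma>, 1], vector [0, 0, \<sigma>]]"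

definition triples_a :: "(nat \<times> nat \<times> nat) set" where
  "triples_a = {(1,5,0), (2,0,1), (3,1,2), (4,2,3), (5,3,4), (0,4,5)}"

definition triples_b :: "(nat \<times> nat \<times> nat) set" where
  "triples_b = {(1,2,0), (5,4,0), (2,3,1), (0,5,1), (3,4,2), (4,5,3)}"

definition triples_c :: "(nat \<times> nat \<times> nat) set" where
  "triples_c = {(5,0,1), (1,0,5), (0,1,2), (2,1,0), (1,2,3), (3,2,1),
                (2,3,4), (4,3,2), (3,4,5), (5,4,3), (4,5,0), (0,5,4)}"

text \<open>A representation of \<open>\<Gamma>\<close> is determined by its values at \<open>S\<close> and \<open>T\<close>; these are the
  24 pairs of such values.\<close>

definition list_pairs :: "((complex^3^3) \<times> (complex^3^3)) set" where
  "list_pairs =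
     {(S_a (lam x\<^sub>3 ^ 3), diag3 (lam x\<^sub>1) (lam x\<^sub>2) (lam x\<^sub>3)) | x\<^sub>1 x\<^sub>2 x\<^sub>3. (x\<^sub>1, x\<^sub>2, x\<^sub>3) \<in> triples_a} \<union>
     {(S_b (lam x\<^sub>2 ^ 3), diag3 (lam x\<^sub>1) (lam x\<^sub>2) (lam x\<^sub>3)) | x\<^sub>1 x\<^sub>2 x\<^sub>3. (x\<^sub>1, x\<^sub>2, x\<^sub>3) \<in> triples_b} \<union>
     {(S_c (lam x\<^sub>1 ^ 3), diag3 (lam x\<^sub>1) (lam x\<^sub>2) (lam x\<^sub>3)) | x\<^sub>1 x\<^sub>2 x\<^sub>3. (x\<^sub>1, x\<^sub>2, x\<^sub>3) \<in> triples_c}"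

definition list_L :: "3 rep set" where
  "list_L = {\<rho>. matrix_rep \<rho> \<and> (\<rho> S\<^sub>\<Gamma>, \<rho> T\<^sub>\<Gamma>) \<in> list_pairs}"

lemma mat2_eq_iff:
  "(A::'a^2^2) = B \<longleftrightarrow> A$1$1 = B$1$1 \<and> A$1$2 = B$1$2 \<and> A$2$1 = B$2$1 \<and> A$2$2 = B$2$2"
  by (auto simp: vec_eq_iff forall_2)

lemma mat3_eq_iff:
  "(A::'a^3^3) = B \<longleftrightarrow>
     A$1$1 = B$1$1 \<and> A$1$2 = B$1$2 \<and> A$1$3 = B$1$3 \<and>
     A$2$1 = B$2$1 \<and> A$2$2 = B$2$2 \<and> A$2$3 = B$2$3 \<and>
     A$3$1 = B$3$1 \<and> A$3$2 = B$3$2 \<and> A$3$3 = B$3$3"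
  by (auto simp: vec_eq_iff forall_3)

lemma group_SL2Z: "group SL2Z"
proof (rule groupI)
  fix A assume "A \<in> carrier SL2Z"
  then have d: "A$1$1 * A$2$2 - A$1$2 * A$2$1 = 1"
    by (simp add: SL2Z_def det_2)
  define B :: "int^2^2" where
    "B = vector [vector [A$2$2, - A$1$2], vector [- A$2$1, A$1$1]]"
  have "det B = 1" "B ** A = mat 1"
    using d by (auto simp: B_def det_2 mat2_eq_iff matrix_matrix_mult_def sum_2 mat_def vector_2 algebra_simps)
  then show "\<exists>B\<in>carrier SL2Z. B \<otimes>\<^bsub>SL2Z\<^esub> A = \<one>\<^bsub>SL2Z\<^esub>"
    by (auto simp: SL2Z_def)
qed (auto simp: SL2Z_def det_mul matrix_mul_assoc)

lemma mem_center_SL2Z: "A \<in> {mat 1, - mat 1} \<Longrightarrow> A ** B = B ** (A :: int^2^2)"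
  by (auto simp: mat2_eq_iff matrix_matrix_mult_def sum_2 mat_def)

lemma normal_center_SL2Z: "{mat 1, - mat 1} \<lhd> SL2Z"
proof -
  interpret group SL2Z by (rule group_SL2Z)
  have neg: "(- mat 1) ** (- mat 1) = (mat 1 :: int^2^2)" "det (- mat 1 :: int^2^2) = 1"
    by (auto simp: mat2_eq_iff matrix_matrix_mult_def sum_2 mat_def det_2)
  have "subgroup {mat 1, - mat 1} SL2Z"
  proof (rule subgroupI)
    fix A assume A: "A \<in> {mat 1, - mat 1 :: int^2^2}"
    then have "A \<in> carrier SL2Z" "A \<otimes>\<^bsub>SL2Z\<^esub> A = \<one>\<^bsub>SL2Z\<^esub>"
      using neg by (auto simp: SL2Z_def)
    then show "inv\<^bsub>SL2Z\<^esub> A \<in> {mat 1, - mat 1}"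
      using A inv_equality by simp
  qed (use neg in \<open>auto simp: SL2Z_def\<close>)
  then show ?thesis
  proof (rule normalI, intro ballI)
    fix B
    show "{mat 1, - mat 1} #>\<^bsub>SL2Z\<^esub> B = B <#\<^bsub>SL2Z\<^esub> {mat 1, - mat 1}"
      unfolding r_coset_def l_coset_def
      using mem_center_SL2Z[of _ B] by (auto simp: SL2Z_def)
  qed
qed

lemma group_PSL2Z: "group PSL2Z"
  unfolding PSL2Z_def by (rule normal.factorgroup_is_group[OF normal_center_SL2Z])

lemma lam_values:
  defines "z \<equiv> lam 1"
  shows "z * z = z - 1" "lam 0 = 1" "lam (Suc 0) = z" "lam 2 = z - 1" "lam 3 = -1"
    "lam 4 = - z" "lam 5 = 1 - z"
proof -
  have lam_pow: "lam n = z ^ n" for n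
    by (simp add: z_def lam_def e_of_def exp_of_nat_mult[symmetric] mult_ac)
  have "z = cis (pi / 3)"
    by (simp add: z_def lam_def e_of_def cis_conv_exp mult_ac)
  then have z: "z = Complex (1/2) (sqrt 3 / 2)"
    by (simp add: complex_eq_iff cos_60 sin_60)
  show zz: "z * z = z - 1"
    by (simp add: z complex_eq_iff field_simps)
  have z3: "z ^ 3 = -1"
    by (simp add: power3_eq_cube zz ring_distribs)
  show "lam 0 = 1" "lam (Suc 0) = z" "lam 2 = z - 1" "lam 3 = -1"
    by (simp_all add: lam_pow power2_eq_square zz z3)
  have "z ^ 4 = z ^ 3 * z" "z ^ 5 = z ^ 3 * (z * z)"
    by (simp_all add: eval_nat_numeral)
  then show "lam 4 = - z" "lam 5 = 1 - z"
    by (simp_all add: lam_pow z3 zz)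
qed

lemma upper_triangular_cube:
  fixes a b c p q r :: complex
  assumes "p ^ 3 = 1" "q ^ 3 = 1" "r ^ 3 = 1"
    and "a * (p * p + p * q + q * q) = 0" "c * (q * q + q * r + r * r) = 0"
    and "b * (p * p + p * r + r * r) + a * c * (p + q + r) = 0"
    and N: "N = vector [vector [p, a, b], vector [0, q, c], vector [0, 0, r]]"
  shows "N ** N ** N = (mat 1 :: complex^3^3)"
  using assms(1-6)
  by (simp add: N mat3_eq_iff matrix_matrix_mult_def sum_3 mat_def power3_eq_cube algebra_simps)

text \<open>The relations \<open>\<rho>(S)\<^sup>2 = \<rho>(ST)\<^sup>3 = 1\<close> present \<open>\<Gamma>\<close>, so every pair does come from a
  representation.\<close>

lemma list_pairs_relations:
  assumes "(A, B) \<in> list_pairs"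
  shows "A ** A = mat 1" "(A ** B) ** (A ** B) ** (A ** B) = mat 1"
proof -
  define z where "z = lam 1"
  note lam = lam_values[folded z_def]
  have z3: "z ^ 3 = -1"
    by (simp add: power3_eq_cube lam(1) algebra_simps)
  have pow3: "(z - 1) ^ 3 = 1" "(1 - z) ^ 3 = -1" "(- z) ^ 3 = 1"
    using z3 by (simp_all add: power3_eq_cube lam(1) algebra_simps)
  have pows: "y ^ 6 = 1" "y ^ 9 = y ^ 3" "y ^ 12 = 1" if "y ^ 3 = 1 \<or> y ^ 3 = -1" for y :: complex
  proof -
    define w where "w = y ^ 3"
    have "y ^ 6 = w ^ 2" "y ^ 9 = w ^ 3" "y ^ 12 = w ^ 4"
      by (simp_all add: w_def)
    moreover have "w = 1 \<or> w = -1"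
      using that by (simp add: w_def)
    ultimately show "y ^ 6 = 1" "y ^ 9 = y ^ 3" "y ^ 12 = 1"
      unfolding w_def[symmetric] by auto
  qed
  note pow = z3 pow3 pows[of z] pows[of "z - 1"] pows[of "1 - z"] pows[of "- z"]
  have zz: "z * (z * c) = (z - 1) * c" for c
    using lam(1) by (simp add: mult.assoc[symmetric])
  have mult_a: "S_a \<sigma> ** S_a \<sigma> = mat 1" if "\<sigma> * \<sigma> = 1" for \<sigma>
    using that by (simp add: S_a_def mat3_eq_iff matrix_matrix_mult_def sum_3 mat_def)
  have mult_b: "S_b \<sigma> ** S_b \<sigma> = mat 1" if "\<sigma> * \<sigma> = 1" for \<sigma>
    using that by (simp add: S_b_def mat3_eq_iff matrix_matrix_mult_def sum_3 mat_def)
  have mult_c: "S_c \<sigma> ** S_c \<sigma> = mat 1" if "\<sigma> * \<sigma> = 1" for \<sigma>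
    using that by (simp add: S_c_def mat3_eq_iff matrix_matrix_mult_def sum_3 mat_def)
  have ST_a: "S_a \<sigma> ** diag3 x y w =
      vector [vector [- \<sigma> * x, 0, w], vector [0, - \<sigma> * y, w], vector [0, 0, \<sigma> * w]]" for \<sigma> x y w
    by (simp add: S_a_def diag3_def mat3_eq_iff matrix_matrix_mult_def sum_3)
  have ST_b: "S_b \<sigma> ** diag3 x y w =
      vector [vector [- \<sigma> * x, y, w], vector [0, \<sigma> * y, 0], vector [0, 0, \<sigma> * w]]" for \<sigma> x y w
    by (simp add: S_b_def diag3_def mat3_eq_iff matrix_matrix_mult_def sum_3)
  have ST_c: "S_c \<sigma> ** diag3 x y w =
      vector [vector [\<sigma> * x, -2 * \<sigma> * y, w], vector [0, - \<sigma> * y, w], vector [0, 0, \<sigma> * w]]"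
    for \<sigma> x y w
    by (simp add: S_c_def diag3_def mat3_eq_iff matrix_matrix_mult_def sum_3)
  consider
    (a) x\<^sub>1 x\<^sub>2 x\<^sub>3 where "A = S_a (lam x\<^sub>3 ^ 3)" "B = diag3 (lam x\<^sub>1) (lam x\<^sub>2) (lam x\<^sub>3)"
      "(x\<^sub>1, x\<^sub>2, x\<^sub>3) \<in> triples_a"
  | (b) x\<^sub>1 x\<^sub>2 x\<^sub>3 where "A = S_b (lam x\<^sub>2 ^ 3)" "B = diag3 (lam x\<^sub>1) (lam x\<^sub>2) (lam x\<^sub>3)"
      "(x\<^sub>1, x\<^sub>2, x\<^sub>3) \<in> triples_b"
  | (c) x\<^sub>1 x\<^sub>2 x\<^sub>3 where "A = S_c (lam x\<^sub>1 ^ 3)" "B = diag3 (lam x\<^sub>1) (lam x\<^sub>2) (lam x\<^sub>3)"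
      "(x\<^sub>1, x\<^sub>2, x\<^sub>3) \<in> triples_c"
    using assms unfolding list_pairs_def by blast
  then have "A ** A = mat 1 \<and> (A ** B) ** (A ** B) ** (A ** B) = mat 1"
  proof cases
    case a
    have "lam x\<^sub>3 ^ 3 * lam x\<^sub>3 ^ 3 = 1"
      using a(3) by (auto simp: triples_a_def lam(2-) pow)
    moreover have "(A ** B) ** (A ** B) ** (A ** B) = mat 1"
      unfolding a(1,2)
      by (rule upper_triangular_cube[OF _ _ _ _ _ _ ST_a])
        (use a(3) in \<open>auto simp: triples_a_def lam pow zz power_mult_distrib algebra_simps\<close>)
    ultimately show ?thesis
      using a(1) mult_a by simp
  next
    case b
    have "lam x\<^sub>2 ^ 3 * lam x\<^sub>2 ^ 3 = 1"
      using b(3) by (auto simp: triples_b_def lam(2-) pow)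
    moreover have "(A ** B) ** (A ** B) ** (A ** B) = mat 1"
      unfolding b(1,2)
      by (rule upper_triangular_cube[OF _ _ _ _ _ _ ST_b])
        (use b(3) in \<open>auto simp: triples_b_def lam pow zz power_mult_distrib algebra_simps\<close>)
    ultimately show ?thesis
      using b(1) mult_b by simp
  next
    case c
    have "lam x\<^sub>1 ^ 3 * lam x\<^sub>1 ^ 3 = 1"
      using c(3) by (auto simp: triples_c_def lam(2-) pow)
    moreover have "(A ** B) ** (A ** B) ** (A ** B) = mat 1"
      unfolding c(1,2)
      by (rule upper_triangular_cube[OF _ _ _ _ _ _ ST_c])
        (use c(3) in \<open>auto simp: triples_c_def lam pow zz power_mult_distrib algebra_simps\<close>)
    ultimately show ?thesis
      using c(1) mult_c by simp
  qed
  then show "A ** A = mat 1" "(A ** B) ** (A ** B) ** (A ** B) = mat 1"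
    by auto
qed

end

theory Submission
  imports Defs
begin

text \<open>
  Choose an eigenbasis of \<open>\<rho>(T)\<close> whose first vector spans \<open>\<rho>\<^sub>0\<close>. An invariant plane is the kernel of a
  common left eigenvector of \<open>\<rho>(S)\<close> and \<open>\<rho>(T)\<close>. A common left eigenvector that does not vanish on a
  common right eigenvector splits off a line, so indecomposability makes all these pairings vanish.
  If there is an invariant plane, it therefore contains the line of \<open>\<rho>\<^sub>0\<close>, and the eigenbasis can be adapted
  to the flag. Then \<open>\<rho>(S)\<close> is upper triangular, the relations \<open>S\<^sup>2 = (ST)\<^sup>3 = 1\<close> and the vanishing of the
  pairings determine which entries are nonzero and force the diagonal of \<open>\<rho>(ST)\<close> to consist of the
  three cube roots of unity, and rescaling the basis gives the list.

  Without an invariant plane, \<open>\<rho>\<^sub>1\<close> is irreducible and \<open>\<rho>'\<close> can be taken to be the dual of \<open>\<rho>\<close>, with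
  \<open>\<rho>\<^sub>0' = \<rho>\<^sub>1\<^sup>*\<close>. If the eigenvalues of \<open>\<rho>\<^sub>1(T)\<close> were \<open>m\<close> and \<open>- m\<close>, the relations would produce a common left
  eigenvector of \<open>\<rho>(S)\<close> and \<open>\<rho>(T)\<close>, hence an invariant plane.
\<close>

section \<open>Generation of the modular group\<close>

abbreviation S_mat :: "int^2^2" where "S_mat \<equiv> vector [vector [0, -1], vector [1, 0]]"
abbreviation T_mat :: "int^2^2" where "T_mat \<equiv> vector [vector [1, 1], vector [0, 1]]"

text \<open>Euclid's algorithm on the first column, by strong induction on the absolute value of the
  lower left entry. Only left multiplication by \<open>S_mat\<close> and \<open>T_mat\<close> is
  available, so \<open>-1\<close> is obtained as \<open>S_mat ** S_mat\<close>, and negative powers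
  of \<open>T_mat\<close> through \<open>T_inv\<close>. \<open>U n\<close> is the n-th power of
  \<open>T_mat\<close>.\<close>

lemma SL2Z_induct:
  assumes "det A = 1"
    and one: "P (mat 1)"
    and S: "\<And>B. det B = 1 \<Longrightarrow> P B \<Longrightarrow> P (S_mat ** B)"
    and T: "\<And>B. det B = 1 \<Longrightarrow> P B \<Longrightarrow> P (T_mat ** B)"
  shows "P A"
proof -
  have det: "det S_mat = 1" "det T_mat = 1"
    by (simp_all add: det_2)
  define U where "U n = (vector [vector [1, n], vector [0, 1]] :: int^2^2)" for n
  have detU: "det (U n) = 1" for n
    by (simp add: U_def det_2)
  have U_mult: "U m ** U n = U (m + n)" for m n
    by (simp add: U_def mat2_eq_iff matrix_matrix_mult_def sum_2)
  have neg1: "P (- B)" if "det B = 1" "P B" for B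
  proof -
    have "- B = S_mat ** (S_mat ** B)"
      by (simp add: mat2_eq_iff matrix_matrix_mult_def sum_2)
    then show ?thesis
      using S that det by (simp add: det_mul)
  qed
  have T_inv: "P (U (-1) ** B)" if B: "det B = 1" "P B" for B
  proof -
    \<comment> \<open>\<open>(ST)\<^sup>3 = - 1\<close> in \<open>SL\<^sub>2(\<int>)\<close>, so \<open>T\<^sup>-\<^sup>1 = - STSTS\<close>\<close>
    have "U (-1) ** B = - (S_mat ** (T_mat ** (S_mat ** (T_mat ** (S_mat ** B)))))"
      by (simp add: U_def mat2_eq_iff matrix_matrix_mult_def sum_2)
    moreover have "P (S_mat ** (T_mat ** (S_mat ** (T_mat ** (S_mat ** B)))))"
      using B by (intro S T) (simp_all add: det_mul det)
    ultimately show ?thesis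
      using neg1 B by (simp add: det_mul det)
  qed
  have P_U: "P (U n ** B)" if B: "det B = 1" "P B" for n B
  proof (induction n rule: int_induct[where k = 0])
    case base
    have "U 0 = mat 1"
      by (simp add: U_def mat2_eq_iff mat_def)
    then show ?case
      using B by simp
  next
    case (step1 n)
    have "U (n + 1) ** B = T_mat ** (U n ** B)"
      using U_mult[of 1 n] by (simp add: matrix_mul_assoc U_def add.commute)
    then show ?case
      using T step1 B detU by (simp add: det_mul)
  next
    case (step2 n)
    have "U (n - 1) ** B = U (- 1) ** (U n ** B)"
      using U_mult[of "-1" n] by (simp add: matrix_mul_assoc add.commute)
    then show ?case
      using T_inv step2 B detU by (simp add: det_mul)
  qed
  from \<open>det A = 1\<close> show ?thesis
  proof (induction "nat \<bar>A $ 2 $ 1\<bar>" arbitrary: A rule: less_induct)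
    case less
    show ?case
    proof (cases "A $ 2 $ 1 = 0")
      case True
      then have "A $ 1 $ 1 * A $ 2 $ 2 = 1"
        using less.prems by (simp add: det_2)
      then consider "A $ 1 $ 1 = 1" "A $ 2 $ 2 = 1" | "A $ 1 $ 1 = -1" "A $ 2 $ 2 = -1"
        by (auto simp: zmult_eq_1_iff)
      then show ?thesis
      proof cases
        case 1
        then have "A = U (A $ 1 $ 2) ** mat 1"
          using True by (simp add: U_def mat2_eq_iff)
        then show ?thesis
          using P_U[of "mat 1" "A $ 1 $ 2"] one by simp
      next
        case 2
        then have "A = - (U (- (A $ 1 $ 2)) ** mat 1)"
          using True by (simp add: U_def mat2_eq_iff)
        moreover have "P (- (U (- (A $ 1 $ 2)) ** mat 1))"
          using P_U[of "mat 1"] one detU by (intro neg1) (simp_all add: det_mul)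
        ultimately show ?thesis
          by metis
      qed
    next
      case False
      \<comment> \<open>\<open>U n\<close> replaces \<open>A $ 1 $ 1\<close> by its remainder modulo
        \<open>A $ 2 $ 1\<close>, and \<open>S_mat\<close> moves that remainder to the lower left
        corner. Undoing this costs a sign because \<open>S_mat\<close> squares to
        \<open>-1\<close>.\<close>
      define n where "n = - (A $ 1 $ 1 div A $ 2 $ 1)"
      define B where "B = S_mat ** (U n ** A)"
      have "B $ 2 $ 1 = A $ 1 $ 1 mod A $ 2 $ 1"
        by (simp add: B_def U_def n_def matrix_matrix_mult_def sum_2 minus_div_mult_eq_mod[symmetric])
      then have "nat \<bar>B $ 2 $ 1\<bar> < nat \<bar>A $ 2 $ 1\<bar>"
        using False abs_mod_less[of "A $ 2 $ 1" "A $ 1 $ 1"] by simp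
      moreover have detB: "det B = 1"
        by (simp add: B_def det_mul det detU less.prems)
      ultimately have "P B"
        using less.hyps by blast
      moreover have "A = - (U (- n) ** (S_mat ** B))"
        by (simp add: B_def U_def mat2_eq_iff matrix_matrix_mult_def sum_2)
      ultimately show ?thesis
        using neg1 P_U S detB detU det by (simp add: det_mul)
    qed
  qed
qed

lemma one_PSL2Z: "\<one>\<^bsub>PSL2Z\<^esub> = PSL2Z_image (mat 1)" "PSL2Z_image (- mat 1) = PSL2Z_image (mat 1)"
  by (auto simp: PSL2Z_def PSL2Z_image_def FactGroup_def r_coset_def SL2Z_def mat2_eq_iff
      matrix_matrix_mult_def sum_2 mat_def)

lemma carrier_PSL2Z: "carrier PSL2Z = PSL2Z_image ` {A. det A = 1}"
  by (auto simp: PSL2Z_def PSL2Z_image_def FactGroup_def RCOSETS_def SL2Z_def)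

lemma mult_PSL2Z:
  "det A = 1 \<Longrightarrow> det B = 1 \<Longrightarrow>
    PSL2Z_image A \<otimes>\<^bsub>PSL2Z\<^esub> PSL2Z_image B = PSL2Z_image (A ** B)"
  using normal.rcos_sum[OF normal_center_SL2Z, of A B]
  by (simp add: PSL2Z_def PSL2Z_image_def FactGroup_def SL2Z_def)

lemma det_S_T_mat: "det S_mat = 1" "det T_mat = 1"
  by (simp_all add: det_2)

lemma S_T_in_PSL2Z: "S\<^sub>\<Gamma> \<in> carrier PSL2Z" "T\<^sub>\<Gamma> \<in> carrier PSL2Z"
  using det_S_T_mat by (auto simp: S\<^sub>\<Gamma>_def T\<^sub>\<Gamma>_def carrier_PSL2Z)

lemma PSL2Z_induct [consumes 1, case_names one S T]:
  assumes "\<gamma> \<in> carrier PSL2Z"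
    and one: "P \<one>\<^bsub>PSL2Z\<^esub>"
    and S: "\<And>\<gamma>. \<gamma> \<in> carrier PSL2Z \<Longrightarrow> P \<gamma> \<Longrightarrow> P (S\<^sub>\<Gamma> \<otimes>\<^bsub>PSL2Z\<^esub> \<gamma>)"
    and T: "\<And>\<gamma>. \<gamma> \<in> carrier PSL2Z \<Longrightarrow> P \<gamma> \<Longrightarrow> P (T\<^sub>\<Gamma> \<otimes>\<^bsub>PSL2Z\<^esub> \<gamma>)"
  shows "P \<gamma>"
proof -
  obtain A where A: "det A = 1" "\<gamma> = PSL2Z_image A"
    using assms(1) by (auto simp: carrier_PSL2Z)
  from A(1) have "P (PSL2Z_image A)"
  proof (rule SL2Z_induct[where P = "\<lambda>A. P (PSL2Z_image A)"])
    show "P (PSL2Z_image (mat 1))"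
      using one by (simp add: one_PSL2Z)
  next
    fix B :: "int^2^2" assume B: "det B = 1" "P (PSL2Z_image B)"
    then show "P (PSL2Z_image (S_mat ** B))" "P (PSL2Z_image (T_mat ** B))"
      using S[of "PSL2Z_image B"] T[of "PSL2Z_image B"] mult_PSL2Z det_S_T_mat
      by (auto simp: carrier_PSL2Z S\<^sub>\<Gamma>_def T\<^sub>\<Gamma>_def)
  qed
  then show ?thesis
    using A by simp
qed

lemma PSL2Z_relations:
  "S\<^sub>\<Gamma> \<otimes>\<^bsub>PSL2Z\<^esub> S\<^sub>\<Gamma> = \<one>\<^bsub>PSL2Z\<^esub>"
  "(S\<^sub>\<Gamma> \<otimes>\<^bsub>PSL2Z\<^esub> T\<^sub>\<Gamma>) \<otimes>\<^bsub>PSL2Z\<^esub> (S\<^sub>\<Gamma> \<otimes>\<^bsub>PSL2Z\<^esub> T\<^sub>\<Gamma>) \<otimes>\<^bsub>PSL2Z\<^esub>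
    (S\<^sub>\<Gamma> \<otimes>\<^bsub>PSL2Z\<^esub> T\<^sub>\<Gamma>) = \<one>\<^bsub>PSL2Z\<^esub>"
proof -
  have "S_mat ** S_mat = - mat 1" "S_mat ** T_mat ** (S_mat ** T_mat) ** (S_mat ** T_mat) = - mat 1"
    by (simp_all add: mat2_eq_iff matrix_matrix_mult_def sum_2 mat_def)
  then show "S\<^sub>\<Gamma> \<otimes>\<^bsub>PSL2Z\<^esub> S\<^sub>\<Gamma> = \<one>\<^bsub>PSL2Z\<^esub>"
  "(S\<^sub>\<Gamma> \<otimes>\<^bsub>PSL2Z\<^esub> T\<^sub>\<Gamma>) \<otimes>\<^bsub>PSL2Z\<^esub> (S\<^sub>\<Gamma> \<otimes>\<^bsub>PSL2Z\<^esub> T\<^sub>\<Gamma>) \<otimes>\<^bsub>PSL2Z\<^esub>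
    (S\<^sub>\<Gamma> \<otimes>\<^bsub>PSL2Z\<^esub> T\<^sub>\<Gamma>) = \<one>\<^bsub>PSL2Z\<^esub>"
    by (simp_all add: S\<^sub>\<Gamma>_def T\<^sub>\<Gamma>_def mult_PSL2Z det_mul det_S_T_mat one_PSL2Z)
qed

section \<open>Matrix representations\<close>

lemma matrix_inv_mult:
  fixes A :: "'a::field^'n^'n"
  assumes "invertible A"
  shows "A ** matrix_inv A = mat 1" "matrix_inv A ** A = mat 1"
  using someI_ex[OF assms[unfolded invertible_def]] by (simp_all add: matrix_inv_def)

lemma invertible_matrix_inv:
  fixes A :: "'a::field^'n^'n"
  shows "invertible A \<Longrightarrow> invertible (matrix_inv A)"
  using matrix_inv_mult unfolding invertible_def by blast

lemma matrix_rep_invertible: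
  "matrix_rep \<rho> \<Longrightarrow> \<gamma> \<in> carrier PSL2Z \<Longrightarrow> invertible (\<rho> \<gamma>)"
  by (auto simp: matrix_rep_def hom_def GL_def)

lemma matrix_rep_mult:
  "matrix_rep \<rho> \<Longrightarrow> \<gamma> \<in> carrier PSL2Z \<Longrightarrow> \<delta> \<in> carrier PSL2Z \<Longrightarrow>
    \<rho> (\<gamma> \<otimes>\<^bsub>PSL2Z\<^esub> \<delta>) = \<rho> \<gamma> ** \<rho> \<delta>"
  by (auto simp: matrix_rep_def hom_def GL_def)

lemma matrix_rep_one:
  assumes "matrix_rep \<rho>"
  shows "\<rho> \<one>\<^bsub>PSL2Z\<^esub> = mat 1"
proof -
  interpret group PSL2Z by (rule group_PSL2Z)
  let ?A = "\<rho> \<one>\<^bsub>PSL2Z\<^esub>"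
  have inv: "invertible ?A" and "?A ** ?A = ?A"
    using assms matrix_rep_invertible matrix_rep_mult[of \<rho> "\<one>\<^bsub>PSL2Z\<^esub>" "\<one>\<^bsub>PSL2Z\<^esub>"] by auto
  then have "matrix_inv ?A ** ?A ** ?A = matrix_inv ?A ** ?A"
    by (metis matrix_mul_assoc)
  then show ?thesis
    by (simp add: matrix_inv_mult[OF inv])
qed

lemma matrix_rep_inv:
  assumes "matrix_rep \<rho>" "\<gamma> \<in> carrier PSL2Z"
  shows "\<rho> \<gamma> ** \<rho> (inv\<^bsub>PSL2Z\<^esub> \<gamma>) = mat 1" "\<rho> (inv\<^bsub>PSL2Z\<^esub> \<gamma>) ** \<rho> \<gamma> = mat 1"
proof -
  interpret group PSL2Z by (rule group_PSL2Z)
  show "\<rho> \<gamma> ** \<rho> (inv\<^bsub>PSL2Z\<^esub> \<gamma>) = mat 1" "\<rho> (inv\<^bsub>PSL2Z\<^esub> \<gamma>) ** \<rho> \<gamma> = mat 1"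
    using assms matrix_rep_mult[of \<rho> \<gamma> "inv\<^bsub>PSL2Z\<^esub> \<gamma>"] matrix_rep_mult[of \<rho> "inv\<^bsub>PSL2Z\<^esub> \<gamma>" \<gamma>]
    by (auto simp: matrix_rep_one)
qed

lemma matrix_rep_relations:
  assumes "matrix_rep \<rho>"
  shows "\<rho> S\<^sub>\<Gamma> ** \<rho> S\<^sub>\<Gamma> = mat 1"
    "(\<rho> S\<^sub>\<Gamma> ** \<rho> T\<^sub>\<Gamma>) ** (\<rho> S\<^sub>\<Gamma> ** \<rho> T\<^sub>\<Gamma>) ** (\<rho> S\<^sub>\<Gamma> ** \<rho> T\<^sub>\<Gamma>) = mat 1"
proof -
  interpret group PSL2Z by (rule group_PSL2Z)
  show "\<rho> S\<^sub>\<Gamma> ** \<rho> S\<^sub>\<Gamma> = mat 1"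
    "(\<rho> S\<^sub>\<Gamma> ** \<rho> T\<^sub>\<Gamma>) ** (\<rho> S\<^sub>\<Gamma> ** \<rho> T\<^sub>\<Gamma>) ** (\<rho> S\<^sub>\<Gamma> ** \<rho> T\<^sub>\<Gamma>) = mat 1"
    using arg_cong[OF PSL2Z_relations(1), of \<rho>] arg_cong[OF PSL2Z_relations(2), of \<rho>] assms
    by (simp_all add: matrix_rep_mult S_T_in_PSL2Z matrix_rep_one)
qed

text \<open>Words in \<open>S\<^sub>\<Gamma>\<close> and \<open>T\<^sub>\<Gamma>\<close> without
  inverses already exhaust \<Gamma>, so induction along such words suffices.\<close>

lemma invariant_subspaceI:
  assumes "matrix_rep \<rho>" "vec.subspace W"
    and "\<And>v. v \<in> W \<Longrightarrow> \<rho> S\<^sub>\<Gamma> *v v \<in> W" "\<And>v. v \<in> W \<Longrightarrow> \<rho> T\<^sub>\<Gamma> *v v \<in> W"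
  shows "invariant_subspace \<rho> W"
  unfolding invariant_subspace_def
proof (intro conjI ballI)
  fix \<gamma> v assume "\<gamma> \<in> carrier PSL2Z" and v: "v \<in> W"
  then show "\<rho> \<gamma> *v v \<in> W"
    by (induction rule: PSL2Z_induct)
       (use v assms in \<open>auto simp: matrix_rep_one matrix_rep_mult S_T_in_PSL2Z
         simp flip: matrix_vector_mul_assoc\<close>)
qed fact

section \<open>Invariant subspaces, decomposability and duals\<close>

text \<open>\<open>scalar_product\<close> involves no complex conjugation, so its left argument acts
  as a linear functional, and \<open>v*\<close> is the pullback of functionals along a
  matrix.\<close>

lemma scalar_product_vector_matrix:
  fixes A :: "'a::field^'n^'m"
  shows "scalar_product (\<phi> v* A) v = scalar_product \<phi> (A *v v)"
proof -
  have "scalar_product (\<phi> v* A) v = (\<Sum>j\<in>UNIV. \<Sum>i\<in>UNIV. \<phi> $ i * A $ i $ j * v $ j)"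
    by (simp add: scalar_product_def vector_matrix_mult_def sum_distrib_right sum_distrib_left mult_ac)
  also have "\<dots> = (\<Sum>i\<in>UNIV. \<Sum>j\<in>UNIV. \<phi> $ i * A $ i $ j * v $ j)"
    by (rule sum.swap)
  also have "\<dots> = scalar_product \<phi> (A *v v)"
    by (simp add: scalar_product_def matrix_vector_mult_def sum_distrib_left mult_ac)
  finally show ?thesis .
qed

lemma scalar_product_simps:
  fixes \<phi> v w :: "'a::field^'n"
  shows "scalar_product \<phi> (v + w) = scalar_product \<phi> v + scalar_product \<phi> w"
    "scalar_product \<phi> (v - w) = scalar_product \<phi> v - scalar_product \<phi> w"
    "scalar_product \<phi> (c *s v) = c * scalar_product \<phi> v"
    "scalar_product (c *s \<phi>) v = c * scalar_product \<phi> v"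
    "scalar_product \<phi> 0 = 0"
    "scalar_product \<phi> (axis i 1) = \<phi> $ i"
  by (simp_all add: scalar_product_def sum.distrib sum_subtractf sum_distrib_left
      algebra_simps axis_def if_distrib cong: if_cong)

lemma functional_nonzero:
  fixes \<phi> :: "'a::field^'n"
  assumes "\<phi> \<noteq> 0"
  obtains y where "scalar_product \<phi> y = 1"
proof -
  obtain i where "\<phi> $ i \<noteq> 0"
    using assms by (auto simp: vec_eq_iff)
  then have "scalar_product \<phi> (inverse (\<phi> $ i) *s axis i 1) = 1"
    by (simp only: scalar_product_simps) simp
  then show thesis
    by (rule that)
qed

lemma proper_subspace_annihilator:
  fixes X :: "('a::field^'n) set"
  assumes "vec.subspace X" "X \<noteq> UNIV"
  obtains \<phi> where "\<phi> \<noteq> 0" "\<And>x. x \<in> X \<Longrightarrow> scalar_product \<phi> x = 0"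
proof -
  obtain y where y: "y \<notin> X"
    using assms(2) by auto
  obtain B where B: "B \<subseteq> X" "vec.independent B" "X \<subseteq> vec.span B"
    by (rule vec.basis_exists[of X]) auto
  have "y \<notin> vec.span B"
    using y vec.span_minimal[OF B(1) assms(1)] by blast
  then have "vec.independent (insert y B)" "y \<notin> B"
    using B(2) vec.independent_insertI vec.span_base by blast+
  \<comment> \<open>The linear extension used here maps \<open>'a^'n\<close> to itself, so the
    functional is read off as one coordinate of it. The index \<open>undefined\<close> is an
    arbitrary choice: \<open>g\<close> sends \<open>y\<close> to the axis vector at that index and
    kills \<open>B\<close>.\<close>
  then obtain g :: "'a^'n \<Rightarrow> 'a^'n" where g: "Vector_Spaces.linear (*s) (*s) g"
      and gB: "\<forall>x\<in>insert y B. g x = (if x = y then axis undefined 1 else 0)"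
    using vec.linear_independent_extend[of "insert y B" "\<lambda>x. if x = y then axis undefined 1 else 0"]
    by blast
  define \<phi> where "\<phi> = matrix g $ undefined"
  have sp: "scalar_product \<phi> x = g x $ undefined" for x
    using matrix_works[OF g, of x, symmetric]
    by (simp add: \<phi>_def scalar_product_def matrix_vector_mult_def)
  have "scalar_product \<phi> y = 1"
    using gB by (simp add: sp axis_def)
  then have "\<phi> \<noteq> 0"
    by (auto simp: scalar_product_def)
  moreover have "scalar_product \<phi> x = 0" if "x \<in> X" for x
  proof -
    have "g x = 0"
    proof (rule vec.linear_eq_0_on_span[OF g])
      show "g b = 0" if "b \<in> B" for b
        using gB that \<open>y \<notin> B\<close> by auto
      show "x \<in> vec.span B"
        using that B(3) by blast
    qed
    then show ?thesis
      by (simp add: sp)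
  qed
  ultimately show thesis
    by (rule that)
qed

lemma subspace_kernel: "vec.subspace {v. scalar_product (\<phi> :: 'a::field^'n) v = 0}"
  by (auto simp: vec.subspace_def scalar_product_simps)

text \<open>One vector \<open>y\<close> of value 1 complements the kernel: z minus the multiple of
  \<open>y\<close> by the value at z lies in the kernel.\<close>

lemma dim_kernel:
  fixes \<phi> :: "'a::field^'n"
  assumes "\<phi> \<noteq> 0"
  shows "Suc (vec.dim {v. scalar_product \<phi> v = 0}) = CARD('n)"
proof -
  let ?W = "{v. scalar_product \<phi> v = 0}"
  obtain y where y: "scalar_product \<phi> y = 1"
    using functional_nonzero[OF assms] .
  have span: "vec.span ?W = ?W"
    by (simp add: vec.span_eq_iff subspace_kernel)
  have "z \<in> vec.span (insert y ?W)" for z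
    unfolding vec.span_insert span
    by (auto simp: scalar_product_simps y intro!: exI[of _ "scalar_product \<phi> z"])
  then have "vec.span (insert y ?W) = UNIV"
    by auto
  then have "vec.dim (insert y ?W) = CARD('n)"
    by (metis vec.dim_span vec_dim_card)
  then show ?thesis
    using y by (simp add: vec.dim_insert span)
qed

lemma common_left_eigenvector_invariant_kernel:
  assumes "matrix_rep \<rho>" "\<phi> v* \<rho> S\<^sub>\<Gamma> = k *s \<phi>" "\<phi> v* \<rho> T\<^sub>\<Gamma> = l *s \<phi>"
  shows "invariant_subspace \<rho> {v. scalar_product \<phi> v = 0}"
  by (rule invariant_subspaceI)
     (auto simp: assms subspace_kernel scalar_product_simps
       simp flip: scalar_product_vector_matrix)

text \<open>A functional vanishing on a hyperplane is unique up to a scalar, and invariance of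
  \<open>W\<close> says that each pullback of \<open>\<phi>\<close> vanishes on \<open>W\<close>
  again.\<close>

lemma invariant_hyperplane_common_left_eigenvector:
  fixes \<rho> :: "'n::finite rep"
  assumes inv: "invariant_subspace \<rho> W" and dim: "Suc (vec.dim W) = CARD('n)"
  obtains \<phi> where "\<phi> \<noteq> 0" "\<And>\<gamma>. \<gamma> \<in> carrier PSL2Z \<Longrightarrow> \<exists>c. \<phi> v* \<rho> \<gamma> = c *s \<phi>"
proof -
  have sub: "vec.subspace W"
    using inv by (simp add: invariant_subspace_def)
  have "W \<noteq> UNIV"
    using dim vec_dim_card[where ?'n = 'n] by (metis n_not_Suc_n)
  then obtain \<phi> where \<phi>: "\<phi> \<noteq> 0" "\<And>v. v \<in> W \<Longrightarrow> scalar_product \<phi> v = 0"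
    using proper_subspace_annihilator[OF sub] by metis
  have W: "W = {v. scalar_product \<phi> v = 0}"
    using \<phi> dim dim_kernel[OF \<phi>(1)] by (intro vec.subspace_dim_equal sub subspace_kernel) auto
  obtain y where y: "scalar_product \<phi> y = 1"
    using functional_nonzero[OF \<phi>(1)] .
  have "\<exists>c. \<phi> v* \<rho> \<gamma> = c *s \<phi>" if "\<gamma> \<in> carrier PSL2Z" for \<gamma>
  proof -
    let ?\<psi> = "\<phi> v* \<rho> \<gamma>"
    have ker: "scalar_product ?\<psi> v = 0" if "scalar_product \<phi> v = 0" for v
      using inv that \<open>\<gamma> \<in> carrier PSL2Z\<close> unfolding invariant_subspace_def W
      by (auto simp: scalar_product_vector_matrix)
    \<comment> \<open>\<open>axis i 1 - \<phi> $ i *s y\<close> lies in the kernel of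
      \<open>\<phi>\<close>, so the proportionality factor is the value of the pullback at
      \<open>y\<close>.\<close>
    have "?\<psi> $ i = scalar_product ?\<psi> y * \<phi> $ i" for i
      using ker[of "axis i 1 - \<phi> $ i *s y"] by (simp add: scalar_product_simps y)
    then have "?\<psi> = scalar_product ?\<psi> y *s \<phi>"
      by (simp add: vec_eq_iff)
    then show ?thesis
      by blast
  qed
  then show thesis
    using that \<phi> by blast
qed

section \<open>Decompositions, eigenvectors and commuting idempotents\<close>

lemma decomposableI:
  assumes "invariant_subspace \<rho> U" "invariant_subspace \<rho> W"
    and "U \<noteq> {0}" "W \<noteq> {0}" "U \<inter> W = {0}"
    and "\<And>v. \<exists>u\<in>U. \<exists>w\<in>W. v = u + w"
  shows "\<not> indecomposable \<rho>"
  unfolding indecomposable_def not_not using assms by (intro exI conjI allI)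

text \<open>Otherwise the line through \<open>v\<close> and the kernel of \<open>\<phi>\<close>
  would be complementary invariant subspaces. Dimension at least 2 makes that kernel
  nonzero.\<close>

lemma indecomposable_eigenvectors_orthogonal:
  assumes rep: "matrix_rep \<rho>" and ind: "indecomposable (\<rho> :: 'n::finite rep)" and n: "CARD('n) \<ge> 2"
    and v: "\<rho> S\<^sub>\<Gamma> *v v = k *s v" "\<rho> T\<^sub>\<Gamma> *v v = l *s v"
    and \<phi>: "\<phi> v* \<rho> S\<^sub>\<Gamma> = k' *s \<phi>" "\<phi> v* \<rho> T\<^sub>\<Gamma> = l' *s \<phi>"
  shows "scalar_product \<phi> v = 0"
proof (rule ccontr)
  assume nz: "scalar_product \<phi> v \<noteq> 0"
  let ?U = "range (\<lambda>c. c *s v)" and ?W = "{w. scalar_product \<phi> w = 0}"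
  have "vec.subspace ?U"
    unfolding vec.span_singleton[symmetric] by (rule vec.subspace_span)
  then have U: "invariant_subspace \<rho> ?U"
    by (rule invariant_subspaceI[OF rep])
       (auto simp: vec.scale v mult.commute intro: range_eqI)
  have "\<phi> \<noteq> 0"
    using nz by (auto simp: scalar_product_def)
  then have "vec.dim ?W \<noteq> 0"
    using dim_kernel[of \<phi>] n by linarith
  then have W_nz: "?W \<noteq> {0}"
    unfolding vec.dim_eq_0 by blast
  have v_nz: "v \<noteq> 0"
    using nz by (auto simp: scalar_product_def)
  have "?U \<noteq> {0}"
    using v_nz by (metis rangeI singletonD vec.scale_one)
  moreover have "?U \<inter> ?W = {0}"
    using nz by (auto simp: scalar_product_simps intro: image_eqI[of _ _ 0])
  moreover have "\<exists>u\<in>?U. \<exists>w\<in>?W. x = u + w" for x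
  proof -
    define c where "c = scalar_product \<phi> x / scalar_product \<phi> v"
    have "x = c *s v + (x - c *s v)" "x - c *s v \<in> ?W"
      using nz by (simp_all add: scalar_product_simps c_def)
    then show ?thesis
      by blast
  qed
  ultimately have "\<not> indecomposable \<rho>"
    using U W_nz common_left_eigenvector_invariant_kernel[OF rep \<phi>] by (intro decomposableI)
  then show False
    using ind by contradiction
qed

text \<open>The fixed space and the kernel of \<open>E\<close> are complementary and invariant.
  Together with \<open>decomposable_idempotent\<close> this expresses decomposability by matrices
  instead of subspaces, and such a matrix can simply be transposed to pass to the dual.\<close>

lemma idempotent_decomposes:
  assumes "E ** E = E" "intertwines \<rho> E \<rho>" "E \<noteq> 0" "E \<noteq> mat 1"
  shows "\<not> indecomposable \<rho>"
proof -
  have comm: "E *v (\<rho> \<gamma> *v v) = \<rho> \<gamma> *v (E *v v)" if "\<gamma> \<in> carrier PSL2Z" for \<gamma> v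
    using assms(2) that by (simp add: intertwines_def matrix_vector_mul_assoc)
  have EE: "E *v (E *v v) = E *v v" for v
    by (simp add: matrix_vector_mul_assoc assms(1))
  let ?U = "{v. E *v v = v}" and ?W = "{v. E *v v = 0}"
  have sub: "vec.subspace ?U" "vec.subspace ?W"
    by (auto simp: vec.subspace_def vec.add vec.scale)
  have "invariant_subspace \<rho> ?U" "invariant_subspace \<rho> ?W"
    using sub by (auto simp: invariant_subspace_def comm)
  moreover obtain v where "E *v v \<noteq> 0"
    using assms(3) by (metis matrix_eq matrix_vector_mult_0)
  then have "?U \<noteq> {0}"
    using EE by blast
  moreover obtain w where "E *v w \<noteq> w"
    using assms(4) by (metis matrix_eq matrix_vector_mul_lid)
  then have "?W \<noteq> {0}"
  proof -
    have "w - E *v w \<in> ?W" "w - E *v w \<noteq> 0"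
      using \<open>E *v w \<noteq> w\<close> by (auto simp: vec.diff EE)
    then show ?thesis
      by blast
  qed
  moreover have "?U \<inter> ?W = {0}"
    by auto
  moreover have "\<exists>u\<in>?U. \<exists>w\<in>?W. v = u + w" for v
    by (rule bexI[of _ "E *v v"], rule bexI[of _ "v - E *v v"]) (auto simp: vec.diff EE)
  ultimately show ?thesis
    by (intro decomposableI)
qed

lemma decomposable_idempotent:
  assumes "\<not> indecomposable (\<rho> :: 'n::finite rep)"
  obtains E where "E ** E = E" "intertwines \<rho> E \<rho>" "E \<noteq> 0" "E \<noteq> mat 1"
proof -
  obtain U W where UW: "invariant_subspace \<rho> U" "invariant_subspace \<rho> W"
      "U \<noteq> {0}" "W \<noteq> {0}" "U \<inter> W = {0}" "\<And>v. \<exists>u\<in>U. \<exists>w\<in>W. v = u + w"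
    using assms unfolding indecomposable_def by metis
  have sub: "vec.subspace U" "vec.subspace W"
    using UW by (simp_all add: invariant_subspace_def)
  have "\<exists>u. u \<in> U \<and> v - u \<in> W" for v
    using UW(6)[of v] by auto
  then obtain p where p: "\<And>v. p v \<in> U" "\<And>v. v - p v \<in> W"
    by metis
  \<comment> \<open>\<open>p\<close> is the projection onto \<open>U\<close> along \<open>W\<close>.
    Linearity, idempotence and commutation with \<rho> all come from this uniqueness.\<close>
  have uniq: "p v = u" if "u \<in> U" "v - u \<in> W" for u v
  proof -
    have "p v - u \<in> U"
      using p that sub by (simp add: vec.subspace_diff)
    moreover have "p v - u \<in> W"
      using vec.subspace_diff[OF sub(2) that(2) p(2)[of v]] by simp
    ultimately have "p v - u \<in> {0}"
      unfolding UW(5)[symmetric] by (rule IntI)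
    then show ?thesis
      by simp
  qed
  have "p (x + y) = p x + p y" for x y
    using p sub vec.subspace_add[OF sub(2) p(2)[of x] p(2)[of y]]
    by (intro uniq) (auto simp: vec.subspace_add algebra_simps)
  moreover have "p (c *s x) = c *s p x" for c x
    using p sub vec.subspace_scale[OF sub(2) p(2)[of x], of c]
    by (intro uniq) (auto simp: vec.subspace_scale vec.scale_right_diff_distrib)
  ultimately have "Vector_Spaces.linear (*s) (*s) p"
    by (simp add: Vector_Spaces.linear_iff vec.vector_space_axioms)
  then have E: "matrix p *v v = p v" for v
    by (rule matrix_works)
  have "p (p v) = p v" for v
    using p vec.subspace_0[OF sub(2)] by (intro uniq) auto
  then have "matrix p ** matrix p = matrix p"
    by (simp add: matrix_eq E flip: matrix_vector_mul_assoc)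
  moreover have "p (\<rho> \<gamma> *v v) = \<rho> \<gamma> *v p v" if "\<gamma> \<in> carrier PSL2Z" for \<gamma> v
    using UW(1,2) that p[of v]
    by (intro uniq) (auto simp: invariant_subspace_def simp flip: vec.diff)
  then have "intertwines \<rho> (matrix p) \<rho>"
    by (simp add: intertwines_def matrix_eq E flip: matrix_vector_mul_assoc)
  moreover have "matrix p \<noteq> 0"
  proof
    assume "matrix p = 0"
    then have "p v = 0" for v
      by (metis E matrix_vector_mult_0)
    then have "W = UNIV"
      using p(2) by auto
    then show False
      using UW by auto
  qed
  moreover have "matrix p \<noteq> mat 1"
  proof
    assume "matrix p = mat 1"
    then have "p v = v" for v
      by (metis E matrix_vector_mul_lid)
    then have "U = UNIV"
      using p(1) by (metis UNIV_eq_I)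
    then show False
      using UW by auto
  qed
  ultimately show thesis
    by (rule that)
qed

section \<open>Dual representations\<close>

lemma transpose_inj: "transpose A = transpose B \<longleftrightarrow> A = B"
  by (metis transpose_transpose)

lemma invertible_transpose:
  fixes A :: "'a::field^'n^'n"
  assumes "invertible A"
  shows "invertible (transpose A)"
  using assms by (metis invertible_def matrix_transpose_mul transpose_mat)

text \<open>The restriction to the carrier is essential to the proof: \<open>inv\<close> is
  unspecified elsewhere.\<close>

lemma dual_dual:
  assumes "\<gamma> \<in> carrier PSL2Z"
  shows "dual (dual \<rho>) \<gamma> = \<rho> \<gamma>"
  using group.inv_inv[OF group_PSL2Z assms] by (simp add: dual_def)

lemma matrix_rep_dual:
  assumes "matrix_rep \<rho>"
  shows "matrix_rep (dual \<rho>)"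
proof -
  interpret group PSL2Z by (rule group_PSL2Z)
  show ?thesis
    using assms matrix_rep_invertible[OF assms]
    by (auto simp: matrix_rep_def hom_def GL_def dual_def inv_mult_group matrix_transpose_mul
        intro!: invertible_transpose)
qed

text \<open>Transposition reverses arrows; in this way the quotient map onto
  \<open>\<rho>\<^sub>1\<close> becomes the inclusion of its dual.\<close>

lemma intertwines_dual:
  assumes "intertwines \<rho> M \<rho>'"
  shows "intertwines (dual \<rho>') (transpose M) (dual \<rho>)"
proof -
  interpret group PSL2Z by (rule group_PSL2Z)
  show ?thesis
    using assms by (auto simp: intertwines_def dual_def simp flip: matrix_transpose_mul)
qed

lemma indecomposable_dual:
  assumes "indecomposable \<rho>"
  shows "indecomposable (dual \<rho>)"
proof (rule ccontr)
  assume "\<not> indecomposable (dual \<rho>)"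
  then obtain E where E: "E ** E = E" "intertwines (dual \<rho>) E (dual \<rho>)" "E \<noteq> 0" "E \<noteq> mat 1"
    by (rule decomposable_idempotent)
  have "\<not> indecomposable \<rho>"
  proof (rule idempotent_decomposes)
    show "transpose E ** transpose E = transpose E"
      using E(1) by (metis matrix_transpose_mul)
    show "intertwines \<rho> (transpose E) \<rho>"
      using intertwines_dual[OF E(2)] by (simp add: intertwines_def dual_dual)
    show "transpose E \<noteq> 0"
      using E(3) by (auto simp: vec_eq_iff transpose_def)
    show "transpose E \<noteq> mat 1"
      using E(4) transpose_inj[of E "mat 1"] by (simp add: transpose_mat)
  qed
  then show False
    using assms by blast
qed

lemma invariant_subspace_annihilator:
  assumes "invariant_subspace (dual \<rho>) X"
  shows "invariant_subspace \<rho> {v. \<forall>x\<in>X. scalar_product x v = 0}"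
proof -
  interpret group PSL2Z by (rule group_PSL2Z)
  have "scalar_product x (\<rho> \<gamma> *v v) = 0"
    if "\<gamma> \<in> carrier PSL2Z" "\<forall>x\<in>X. scalar_product x v = 0" "x \<in> X" for \<gamma> v x
  proof -
    \<comment> \<open>At the inverse of \<gamma> the dual is the transpose of
      \<open>\<rho> \<gamma>\<close>, so invariance of \<open>X\<close> there is invariance under
      \<open>v* \<rho> \<gamma>\<close>.\<close>
    have "dual \<rho> (inv\<^bsub>PSL2Z\<^esub> \<gamma>) *v x \<in> X"
      using assms that by (auto simp: invariant_subspace_def)
    then have "x v* \<rho> \<gamma> \<in> X"
      using that by (simp add: dual_def)
    then show ?thesis
      using that by (simp flip: scalar_product_vector_matrix)
  qed
  then show ?thesis
    by (auto simp: invariant_subspace_def vec.subspace_def scalar_product_simps)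
qed

text \<open>The annihilator of an invariant \<open>X\<close> is invariant under \<rho>, hence
  trivial or everything. In the first case a proper \<open>X\<close> would be killed by some nonzero
  functional; in the second \<open>X\<close> can contain no nonzero vector.\<close>

lemma irreducible_dual:
  assumes "irreducible_rep \<rho>"
  shows "irreducible_rep (dual \<rho>)"
  unfolding irreducible_rep_def
proof (intro allI impI)
  fix X assume X: "invariant_subspace (dual \<rho>) X"
  let ?Y = "{v. \<forall>x\<in>X. scalar_product x v = 0}"
  have comm: "scalar_product x y = scalar_product y x" for x y :: "complex^'a"
    by (simp add: scalar_product_def mult.commute)
  have "?Y = {0} \<or> ?Y = UNIV"
    using assms invariant_subspace_annihilator[OF X] unfolding irreducible_rep_def by blast
  then show "X = {0} \<or> X = UNIV"
  proof
    assume Y: "?Y = {0}"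
    have "X = UNIV"
    proof (rule ccontr)
      assume "X \<noteq> UNIV"
      moreover have "vec.subspace X"
        using X by (simp add: invariant_subspace_def)
      ultimately obtain \<phi> where "\<phi> \<noteq> 0" "\<And>x. x \<in> X \<Longrightarrow> scalar_product \<phi> x = 0"
        by (metis proper_subspace_annihilator)
      then have "\<phi> \<in> ?Y - {0}"
        using comm by auto
      then show False
        using Y by blast
    qed
    then show ?thesis ..
  next
    assume Y: "?Y = UNIV"
    have "x = 0" if "x \<in> X" for x
    proof (rule ccontr)
      assume "x \<noteq> 0"
      then obtain y where "scalar_product x y = 1"
        by (rule functional_nonzero)
      moreover have "y \<in> ?Y"
        by (simp only: Y UNIV_I)
      ultimately show False
        using that by auto
    qed
    moreover have "0 \<in> X"
      using X by (simp add: invariant_subspace_def vec.subspace_0)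
    ultimately show ?thesis
      by blast
  qed
qed

section \<open>Bases adapted to a line and to a flag\<close>

lemma scale_vector_matrix:
  fixes A :: "'a::field^'n^'m"
  shows "(c *s \<phi>) v* A = c *s (\<phi> v* A)"
  by (simp add: vec_eq_iff vector_matrix_mult_def sum_distrib_left mult_ac)

lemma adapted_eigenbasis:
  fixes A :: "complex^3^3"
  assumes "diagonalizable A" and v: "A *v v = l *s v" "v \<noteq> 0"
  obtains P l\<^sub>1 l\<^sub>2 l\<^sub>3 where "invertible P" "A ** P = P ** diag3 l\<^sub>1 l\<^sub>2 l\<^sub>3" "P *v axis 1 1 = v"
proof -
  obtain P D :: "complex^3^3" where P: "invertible P" and D: "\<forall>i j. i \<noteq> j \<longrightarrow> D $ i $ j = 0"
      and A: "A = P ** D ** matrix_inv P"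
    using assms(1) unfolding diagonalizable_def by blast
  have AP: "A ** P = P ** D"
    by (simp add: A matrix_inv_mult[OF P] flip: matrix_mul_assoc)
  define c where "c = matrix_inv P *v v"
  have Pc: "P *v c = v"
    by (simp add: c_def matrix_vector_mul_assoc matrix_inv_mult[OF P])
  have "D *v c = matrix_inv P *v (A *v (P *v c))"
    by (simp add: matrix_vector_mul_assoc matrix_inv_mult[OF P] AP matrix_mul_assoc)
  also have "\<dots> = l *s c"
    unfolding Pc v(1) vec.scale by (simp add: c_def)
  finally have Dc: "D $ i $ i * c $ i = l * c $ i" for i
    using D exhaust_3[of i]
    by (auto simp: vec_eq_iff forall_3 matrix_vector_mult_def sum_3)
  have "c \<noteq> 0"
    using Pc v by auto
  then consider "c $ 1 \<noteq> 0" | "c $ 2 \<noteq> 0" | "c $ 3 \<noteq> 0"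
    by (auto simp: vec_eq_iff forall_3)
  \<comment> \<open>Exchange: the columns of \<open>R\<close> are \<open>c\<close>, placed first,
    and the two standard basis vectors left after removing one at which \<open>c\<close> has a
    nonzero coordinate. By \<open>Dc\<close> all of them are eigenvectors of
    \<open>D\<close>.\<close>
  then have "\<exists>R l\<^sub>1 l\<^sub>2 l\<^sub>3. det R \<noteq> 0 \<and> D ** R = R ** diag3 l\<^sub>1 l\<^sub>2 l\<^sub>3 \<and> R *v axis 1 1 = c"
  proof cases
    case 1
    let ?R = "vector [vector [c $ 1, 0, 0], vector [c $ 2, 1, 0], vector [c $ 3, 0, 1]] :: complex^3^3"
    have "det ?R \<noteq> 0 \<and> D ** ?R = ?R ** diag3 l (D $ 2 $ 2) (D $ 3 $ 3) \<and> ?R *v axis 1 1 = c"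
      using 1 D Dc[of 1] Dc[of 2] Dc[of 3] by (auto simp: det_3 mat3_eq_iff diag3_def matrix_matrix_mult_def sum_3
          vec_eq_iff forall_3 matrix_vector_mult_def axis_def mult.commute)
    then show ?thesis by blast
  next
    case 2
    let ?R = "vector [vector [c $ 1, 1, 0], vector [c $ 2, 0, 0], vector [c $ 3, 0, 1]] :: complex^3^3"
    have "det ?R \<noteq> 0 \<and> D ** ?R = ?R ** diag3 l (D $ 1 $ 1) (D $ 3 $ 3) \<and> ?R *v axis 1 1 = c"
      using 2 D Dc[of 1] Dc[of 2] Dc[of 3] by (auto simp: det_3 mat3_eq_iff diag3_def matrix_matrix_mult_def sum_3
          vec_eq_iff forall_3 matrix_vector_mult_def axis_def mult.commute)
    then show ?thesis by blast
  next
    case 3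
    let ?R = "vector [vector [c $ 1, 1, 0], vector [c $ 2, 0, 1], vector [c $ 3, 0, 0]] :: complex^3^3"
    have "det ?R \<noteq> 0 \<and> D ** ?R = ?R ** diag3 l (D $ 1 $ 1) (D $ 2 $ 2) \<and> ?R *v axis 1 1 = c"
      using 3 D Dc[of 1] Dc[of 2] Dc[of 3] by (auto simp: det_3 mat3_eq_iff diag3_def matrix_matrix_mult_def sum_3
          vec_eq_iff forall_3 matrix_vector_mult_def axis_def mult.commute)
    then show ?thesis by blast
  qed
  then obtain R l\<^sub>1 l\<^sub>2 l\<^sub>3 where R: "det R \<noteq> 0" "D ** R = R ** diag3 l\<^sub>1 l\<^sub>2 l\<^sub>3" "R *v axis 1 1 = c"
    by blast
  show thesis
  proof (rule that)
    show "invertible (P ** R)"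
      using P R by (simp add: det_mul invertible_det_nz)
    show "A ** (P ** R) = P ** R ** diag3 l\<^sub>1 l\<^sub>2 l\<^sub>3"
      by (metis AP R(2) matrix_mul_assoc)
    show "P ** R *v axis 1 1 = v"
      by (simp add: R(3) Pc flip: matrix_vector_mul_assoc)
  qed
qed

text \<open>After \<open>v\<close> has been made the first basis vector, the other two are changed
  so that \<open>\<phi>\<close> vanishes on the second one too. \<open>\<psi>\<close> is
  \<open>\<phi>\<close> in the coordinates of the eigenbasis; its first entry vanishes because
  \<open>\<phi>\<close> kills \<open>v\<close>.\<close>

lemma adapted_flag_eigenbasis:
  fixes A :: "complex^3^3"
  assumes A: "diagonalizable A" and v: "A *v v = l *s v" "v \<noteq> 0"
    and \<phi>: "\<phi> v* A = m *s \<phi>" "scalar_product \<phi> v = 0"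
  obtains P l\<^sub>1 l\<^sub>2 l\<^sub>3 f where "invertible P" "A ** P = P ** diag3 l\<^sub>1 l\<^sub>2 l\<^sub>3" "P *v axis 1 1 = v"
    "\<phi> v* P = vector [0, 0, f]"
proof -
  obtain P l\<^sub>1 l\<^sub>2 l\<^sub>3 where P: "invertible P" "A ** P = P ** diag3 l\<^sub>1 l\<^sub>2 l\<^sub>3" "P *v axis 1 1 = v"
    using adapted_eigenbasis[OF A v] .
  define \<psi> where "\<psi> = \<phi> v* P"
  have "scalar_product \<psi> (axis 1 1) = 0"
    by (simp add: \<psi>_def scalar_product_vector_matrix P(3) \<phi>(2))
  then have \<psi>1: "\<psi> $ 1 = 0"
    by (simp add: scalar_product_simps)
  have "\<psi> v* diag3 l\<^sub>1 l\<^sub>2 l\<^sub>3 = \<phi> v* A v* P"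
    by (simp add: \<psi>_def vector_matrix_mul_assoc P(2))
  also have "\<dots> = m *s \<psi>"
    by (simp add: \<phi>(1) \<psi>_def scale_vector_matrix)
  finally have \<psi>m: "\<psi> $ 2 * l\<^sub>2 = m * \<psi> $ 2" "\<psi> $ 3 * l\<^sub>3 = m * \<psi> $ 3"
    by (auto simp: vec_eq_iff forall_3 vector_matrix_mult_def sum_3 diag3_def mult.commute)
  have "\<exists>R l\<^sub>1' l\<^sub>2' l\<^sub>3' f. det R \<noteq> 0 \<and> diag3 l\<^sub>1 l\<^sub>2 l\<^sub>3 ** R = R ** diag3 l\<^sub>1' l\<^sub>2' l\<^sub>3' \<and>
      R *v axis 1 1 = axis 1 1 \<and> \<psi> v* R = vector [0, 0, f]"
  proof (cases "\<psi> $ 3 = 0")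
    case True
    \<comment> \<open>The third basis vector already lies in the kernel of \<open>\<psi>\<close>, so
      the last two are interchanged.\<close>
    let ?R = "vector [vector [1, 0, 0], vector [0, 0, 1], vector [0, 1, 0]] :: complex^3^3"
    have "det ?R \<noteq> 0 \<and> diag3 l\<^sub>1 l\<^sub>2 l\<^sub>3 ** ?R = ?R ** diag3 l\<^sub>1 l\<^sub>3 l\<^sub>2 \<and>
      ?R *v axis 1 1 = axis 1 1 \<and> \<psi> v* ?R = vector [0, 0, \<psi> $ 2]"
      using True \<psi>1 by (simp add: det_3 mat3_eq_iff diag3_def matrix_matrix_mult_def sum_3
          vec_eq_iff forall_3 matrix_vector_mult_def axis_def vector_matrix_mult_def)
    then show ?thesis by blast
  next
    case False
    \<comment> \<open>The new second column lies in the kernel of \<open>\<psi>\<close>. It mixes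
      two eigenvectors, but by \<open>\<psi>m\<close> either \<open>\<psi> $ 2\<close> is zero or
      the two eigenvalues agree.\<close>
    let ?R = "vector [vector [1, 0, 0], vector [0, \<psi> $ 3, 0], vector [0, - (\<psi> $ 2), 1]] :: complex^3^3"
    have "\<psi> $ 2 = 0 \<or> l\<^sub>2 = l\<^sub>3"
      using False \<psi>m by auto
    then have "det ?R \<noteq> 0 \<and> diag3 l\<^sub>1 l\<^sub>2 l\<^sub>3 ** ?R = ?R ** diag3 l\<^sub>1 l\<^sub>2 l\<^sub>3 \<and>
      ?R *v axis 1 1 = axis 1 1 \<and> \<psi> v* ?R = vector [0, 0, \<psi> $ 3]"
      using False \<psi>1 by (auto simp: det_3 mat3_eq_iff diag3_def matrix_matrix_mult_def sum_3
          vec_eq_iff forall_3 matrix_vector_mult_def axis_def vector_matrix_mult_def)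
    then show ?thesis by blast
  qed
  then obtain R l\<^sub>1' l\<^sub>2' l\<^sub>3' f where R: "det R \<noteq> 0" "diag3 l\<^sub>1 l\<^sub>2 l\<^sub>3 ** R = R ** diag3 l\<^sub>1' l\<^sub>2' l\<^sub>3'"
      "R *v axis 1 1 = axis 1 1" "\<psi> v* R = vector [0, 0, f]"
    by blast
  show thesis
  proof (rule that)
    show "invertible (P ** R)"
      using P R by (simp add: det_mul invertible_det_nz)
    show "A ** (P ** R) = P ** R ** diag3 l\<^sub>1' l\<^sub>2' l\<^sub>3'"
      by (metis P(2) R(2) matrix_mul_assoc)
    show "P ** R *v axis 1 1 = v"
      by (simp add: R(3) P(3) flip: matrix_vector_mul_assoc)
    show "\<phi> v* (P ** R) = vector [0, 0, f]"
      using R(4) by (simp add: \<psi>_def vector_matrix_mul_assoc)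
  qed
qed

section \<open>The list\<close>

text \<open>With z = \<open>lam 1\<close> = e(1/6), the elements z - 1 = z^2 and - z = z^4 are
  e(1/3) and e(2/3).\<close>

lemma cube_roots_of_unity:
  assumes "x ^ 3 = 1"
  shows "x = 1 \<or> x = lam 1 - 1 \<or> x = - lam 1"
proof -
  have "(x - 1) * ((x - (lam 1 - 1)) * (x - (- lam 1))) = 0"
    using assms lam_values(1) by algebra
  then show ?thesis
    unfolding mult_eq_0_iff right_minus_eq .
qed

lemma lam_1_cubes:
  "lam 1 ^ 3 = -1" "(lam 1 - 1) ^ 3 = 1" "(1 - lam 1) ^ 3 = -1" "(- lam 1) ^ 3 = 1"
  using lam_values(1) by algebra+

text \<open>In types (a) and (b) two of the basis vectors play symmetric roles, and the list contains
  only one of the two orders.\<close>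

lemma list_pairs_a_I:
  assumes "s = 1 \<or> s = - 1" "p ^ 3 = 1" "q ^ 3 = 1" "r ^ 3 = 1" "p \<noteq> q" "q \<noteq> r" "p \<noteq> r"
  shows "(S_a s, diag3 (- s * p) (- s * q) (s * r)) \<in> list_pairs \<or>
    (S_a s, diag3 (- s * q) (- s * p) (s * r)) \<in> list_pairs"
proof -
  define z where "z = lam 1"
  note lam = lam_values(2-)[folded z_def] lam_1_cubes[folded z_def]
    and roots = cube_roots_of_unity[folded z_def]
  have I: "(S_a s, diag3 l\<^sub>1 l\<^sub>2 l\<^sub>3) \<in> list_pairs"
    if "(x\<^sub>1, x\<^sub>2, x\<^sub>3) \<in> triples_a" "l\<^sub>1 = lam x\<^sub>1" "l\<^sub>2 = lam x\<^sub>2" "l\<^sub>3 = lam x\<^sub>3" "s = lam x\<^sub>3 ^ 3" for l\<^sub>1 l\<^sub>2 l\<^sub>3 x\<^sub>1 x\<^sub>2 x\<^sub>3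
    using that unfolding list_pairs_def by blast
  \<comment> \<open>\<open>p\<close>, \<open>q\<close>, \<open>r\<close> are the diagonal entries of
    the product of the two matrices. The sign \<open>s\<close> and the root \<open>r\<close> give
    six values of \<open>s * r\<close>, one for each triple; \<open>p\<close> and \<open>q\<close>
    are then fixed up to order.\<close>
  have "\<exists>(x\<^sub>1, x\<^sub>2, x\<^sub>3)\<in>triples_a. s = lam x\<^sub>3 ^ 3 \<and> s * r = lam x\<^sub>3 \<and>
      (- s * p = lam x\<^sub>1 \<and> - s * q = lam x\<^sub>2 \<or> - s * q = lam x\<^sub>1 \<and> - s * p = lam x\<^sub>2)"
    using assms(1,5-) roots[OF assms(2)] roots[OF assms(3)] roots[OF assms(4)]
    by (elim disjE) (simp_all add: triples_a_def lam)
  then show ?thesis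
    using I by blast
qed

lemma list_pairs_b_I:
  assumes "s = 1 \<or> s = - 1" "p ^ 3 = 1" "q ^ 3 = 1" "r ^ 3 = 1" "p \<noteq> q" "q \<noteq> r" "p \<noteq> r"
  shows "(S_b s, diag3 (- s * p) (s * q) (s * r)) \<in> list_pairs \<or>
    (S_b s, diag3 (- s * p) (s * r) (s * q)) \<in> list_pairs"
proof -
  define z where "z = lam 1"
  note lam = lam_values(2-)[folded z_def] lam_1_cubes[folded z_def]
    and roots = cube_roots_of_unity[folded z_def]
  have I: "(S_b s, diag3 l\<^sub>1 l\<^sub>2 l\<^sub>3) \<in> list_pairs"
    if "(x\<^sub>1, x\<^sub>2, x\<^sub>3) \<in> triples_b" "l\<^sub>1 = lam x\<^sub>1" "l\<^sub>2 = lam x\<^sub>2" "l\<^sub>3 = lam x\<^sub>3" "s = lam x\<^sub>2 ^ 3" for l\<^sub>1 l\<^sub>2 l\<^sub>3 x\<^sub>1 x\<^sub>2 x\<^sub>3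
    using that unfolding list_pairs_def by blast
  have "\<exists>(x\<^sub>1, x\<^sub>2, x\<^sub>3)\<in>triples_b. s = lam x\<^sub>2 ^ 3 \<and> - s * p = lam x\<^sub>1 \<and>
      (s * q = lam x\<^sub>2 \<and> s * r = lam x\<^sub>3 \<or> s * r = lam x\<^sub>2 \<and> s * q = lam x\<^sub>3)"
    using assms(1,5-) roots[OF assms(2)] roots[OF assms(3)] roots[OF assms(4)]
    by (elim disjE) (simp_all add: triples_b_def lam)
  then show ?thesis
    using I by blast
qed

text \<open>In type (c) no two basis vectors are interchangeable: two signs and six orders of the
  roots account for the twelve triples.\<close>

lemma list_pairs_c_I:
  assumes "s = 1 \<or> s = - 1" "p ^ 3 = 1" "q ^ 3 = 1" "r ^ 3 = 1" "p \<noteq> q" "q \<noteq> r" "p \<noteq> r"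
  shows "(S_c s, diag3 (s * p) (- s * q) (s * r)) \<in> list_pairs"
proof -
  define z where "z = lam 1"
  note lam = lam_values(2-)[folded z_def] lam_1_cubes[folded z_def]
    and roots = cube_roots_of_unity[folded z_def]
  have I: "(S_c s, diag3 l\<^sub>1 l\<^sub>2 l\<^sub>3) \<in> list_pairs"
    if "(x\<^sub>1, x\<^sub>2, x\<^sub>3) \<in> triples_c" "l\<^sub>1 = lam x\<^sub>1" "l\<^sub>2 = lam x\<^sub>2" "l\<^sub>3 = lam x\<^sub>3" "s = lam x\<^sub>1 ^ 3" for l\<^sub>1 l\<^sub>2 l\<^sub>3 x\<^sub>1 x\<^sub>2 x\<^sub>3
    using that unfolding list_pairs_def by blast
  have "\<exists>(x\<^sub>1, x\<^sub>2, x\<^sub>3)\<in>triples_c. s = lam x\<^sub>1 ^ 3 \<and> s * p = lam x\<^sub>1 \<and> - s * q = lam x\<^sub>2 \<and> s * r = lam x\<^sub>3"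
    using assms(1,5-) roots[OF assms(2)] roots[OF assms(3)] roots[OF assms(4)]
    by (elim disjE) (simp_all add: triples_c_def lam)
  then show ?thesis
    using I by blast
qed

text \<open>The quadratic form is the cofactor of p - q in p^3 - q^3, and it is 3 p^2 when p = q. It
  arises as the coefficient of an entry above the diagonal in the cube of a triangular
  matrix.\<close>

lemma cube_roots_distinct:
  fixes p q :: complex
  assumes "p ^ 3 = 1" "q ^ 3 = 1"
  shows "p \<noteq> q \<longleftrightarrow> p * p + p * q + q * q = 0"
proof
  assume "p \<noteq> q"
  moreover have "(p - q) * (p * p + p * q + q * q) = 0"
    using assms by algebra
  ultimately show "p * p + p * q + q * q = 0"
    by simp
next
  assume *: "p * p + p * q + q * q = 0"
  show "p \<noteq> q"
  proof
    assume "p = q"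
    then have "p * p = 0"
      using * by simp
    then show False
      using assms by simp
  qed
qed

text \<open>The cases are distinguished by which of \<open>a\<close> and \<open>c\<close> vanish.
  Both nonzero gives type (c), only \<open>a\<close> nonzero type (b), only \<open>c\<close> nonzero
  type (a). An off-diagonal entry that should not vanish is protected by \<open>orth\<close>; the
  relation for \<open>S ** T\<close> or \<open>orth\<close> makes \<open>p\<close>,
  \<open>q\<close>, \<open>r\<close> distinct.\<close>

lemma upper_triangular_in_list:
  fixes S T :: "complex^3^3"
  assumes S: "S = vector [vector [s\<^sub>1, a, b], vector [0, s\<^sub>2, c], vector [0, 0, s\<^sub>3]]"
    and T: "T = diag3 l\<^sub>1 l\<^sub>2 l\<^sub>3"
    and SS: "S ** S = mat 1" and ST: "(S ** T) ** (S ** T) ** (S ** T) = mat 1"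
    and orth: "\<And>v \<phi> k l k' l'. S *v v = k *s v \<Longrightarrow> T *v v = l *s v \<Longrightarrow>
      \<phi> v* S = k' *s \<phi> \<Longrightarrow> \<phi> v* T = l' *s \<phi> \<Longrightarrow> scalar_product \<phi> v = 0"
  obtains R S' T' where "invertible R" "(S', T') \<in> list_pairs" "S ** R = R ** S'" "T ** R = R ** T'"
proof -
  define p where "p = s\<^sub>1 * l\<^sub>1"
  define q where "q = s\<^sub>2 * l\<^sub>2"
  define r where "r = s\<^sub>3 * l\<^sub>3"
  note pqr_def = p_def q_def r_def
  have s: "s\<^sub>1 * s\<^sub>1 = 1" "s\<^sub>2 * s\<^sub>2 = 1" "s\<^sub>3 * s\<^sub>3 = 1"
    and SS': "a * (s\<^sub>2 + s\<^sub>1) = 0" "c * (s\<^sub>3 + s\<^sub>2) = 0" "b * (s\<^sub>3 + s\<^sub>1) + a * c = 0"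
    using SS by (simp_all only: mat3_eq_iff) (simp_all add: S matrix_matrix_mult_def sum_3 mat_def algebra_simps)
  then have ac: "a = 0 \<or> s\<^sub>2 = - s\<^sub>1" "c = 0 \<or> s\<^sub>3 = - s\<^sub>2" "a * c = 0 \<Longrightarrow> b = 0 \<or> s\<^sub>3 = - s\<^sub>1"
    by (auto simp: add_eq_0_iff2)
  have sgn: "s\<^sub>1 = 1 \<or> s\<^sub>1 = - 1" "s\<^sub>2 = 1 \<or> s\<^sub>2 = - 1" "s\<^sub>3 = 1 \<or> s\<^sub>3 = - 1"
    using s by (simp_all add: square_eq_1_iff)
  have "S ** T = vector [vector [p, a * l\<^sub>2, b * l\<^sub>3], vector [0, q, c * l\<^sub>3], vector [0, 0, r]]"
    by (simp add: S T diag3_def mat3_eq_iff matrix_matrix_mult_def sum_3 pqr_def)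
  note ST = ST[unfolded this]
  have cubes: "p ^ 3 = 1" "q ^ 3 = 1" "r ^ 3 = 1"
    using ST by (simp_all add: mat3_eq_iff matrix_matrix_mult_def sum_3 mat_def power3_eq_cube)
  have ST12: "a * l\<^sub>2 * (p * p + p * q + q * q) = 0"
    and ST23: "c * l\<^sub>3 * (q * q + q * r + r * r) = 0"
    and ST13: "b * l\<^sub>3 * (p * p + p * r + r * r) + a * c * l\<^sub>2 * l\<^sub>3 * (p + q + r) = 0"
    using ST by (simp_all only: mat3_eq_iff) (simp_all add: matrix_matrix_mult_def sum_3 mat_def algebra_simps)
  have nz: "p \<noteq> 0" "q \<noteq> 0" "r \<noteq> 0"
    using cubes by auto
  then have l_nz: "l\<^sub>2 \<noteq> 0" "l\<^sub>3 \<noteq> 0"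
    by (auto simp: pqr_def)
  have l: "l\<^sub>1 = s\<^sub>1 * p" "l\<^sub>2 = s\<^sub>2 * q" "l\<^sub>3 = s\<^sub>3 * r"
    using s by (simp_all add: pqr_def flip: mult.assoc)
  note distinct = cube_roots_distinct[OF cubes(1,2)] cube_roots_distinct[OF cubes(2,3)]
    cube_roots_distinct[OF cubes(1,3)]
  note simps = vec_eq_iff forall_3 vector_matrix_mult_def matrix_vector_mult_def sum_3 S T diag3_def
    scalar_product_def
  note mat_simps = S T mat3_eq_iff diag3_def matrix_matrix_mult_def sum_3 det_3 invertible_det_nz
  consider "a = 0" "c = 0" | "a \<noteq> 0" "c \<noteq> 0" | "a \<noteq> 0" "c = 0" | "a = 0" "c \<noteq> 0"
    by blast
  then show thesis
  proof cases
    case 1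
    then have False
      \<comment> \<open>The second basis vector would be a common eigenvector on both sides, and it
        pairs with itself to 1.\<close>
      using orth[of "vector [0, 1, 0]" s\<^sub>2 l\<^sub>2 "vector [0, 1, 0]" s\<^sub>2 l\<^sub>2] by (simp add: simps)
    then show thesis ..
  next
    case 2
    have s23: "s\<^sub>2 = - s\<^sub>1" "s\<^sub>3 = s\<^sub>1"
      using ac 2 by auto
    have ac': "a * c = - 2 * s\<^sub>1 * b"
      using SS'(3) unfolding s23 by algebra
    have b: "b \<noteq> 0"
      using ac' 2 by auto
    have pq: "p \<noteq> q" and qr: "q \<noteq> r"
      using ST12 ST23 2 l_nz distinct by auto
    have "b * l\<^sub>3 * (p * p + p * r + r * r + 2 * q * (p + q + r)) = 0"
      using ST13 s unfolding ac' l(2) s23 by algebra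
    then have *: "p * p + p * r + r * r + 2 * q * (p + q + r) = 0"
      using b l_nz by simp
    have "p \<noteq> r"
    proof
      \<comment> \<open>Subtracting twice the quadratic relation between \<open>p\<close> and
        \<open>q\<close> leaves \<open>p = - 2 * q\<close>, and the cube of the right side is
        -8.\<close>
      assume "p = r"
      have "p * (p + 2 * q) = 0"
        using *[folded \<open>p = r\<close>] iffD1[OF distinct(1) pq] by algebra
      then have "p = - 2 * q"
        using nz by (simp add: add_eq_0_iff2)
      then have "(- 8) * q ^ 3 = 1"
        using cubes(1) by (simp add: power3_eq_cube mult_ac)
      then show False
        using cubes(2) by simp
    qed
    then have L: "(S_c s\<^sub>1, T) \<in> list_pairs"
      using list_pairs_c_I[OF sgn(1) cubes pq qr] by (simp add: T l s23)
    show thesis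
      \<comment> \<open>This scaling turns \<open>b\<close> and \<open>c\<close> into 1 and
        \<open>a\<close> into \<open>a * c / b\<close>, which is \<open>- 2 * s\<^sub>1\<close> by
        \<open>ac'\<close>.\<close>
      by (rule that[OF _ L, of "diag3 b c 1"]) (use b 2 ac' in \<open>auto simp: mat_simps s23 S_c_def\<close>)
  next
    case 3
    have b: "b \<noteq> 0"
      using 3 orth[of "vector [0, 0, 1]" s\<^sub>3 l\<^sub>3 "vector [0, 0, 1]" s\<^sub>3 l\<^sub>3] by (auto simp: simps)
    have s23: "s\<^sub>2 = - s\<^sub>1" "s\<^sub>3 = - s\<^sub>1"
      using ac 3 b by auto
    have pq: "p \<noteq> q" and pr: "p \<noteq> r"
      using ST12 ST13 3 b l_nz distinct by auto
    have qr: "q \<noteq> r"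
    proof
      assume "q = r"
      \<comment> \<open>Now \<open>l\<^sub>2 = l\<^sub>3\<close> and
        \<open>s\<^sub>2 = s\<^sub>3\<close>. The vector \<open>[0, - b, a]\<close> cancels the two
        entries of the first row, so it is a common eigenvector; its pairing with the last
        coordinate functional is \<open>a\<close>.\<close>
      then have "a = 0"
        using orth[of "vector [0, - b, a]" s\<^sub>2 l\<^sub>2 "vector [0, 0, 1]" s\<^sub>3 l\<^sub>3] 3
        by (simp add: simps s23 l mult_ac)
      then show False
        using 3 by simp
    qed
    have "s\<^sub>1 = - s\<^sub>2"
      using s23 by simp
    note L = list_pairs_b_I[OF sgn(2) cubes pq qr pr]
    from L show thesis
    proof
      assume L: "(S_b s\<^sub>2, diag3 (- s\<^sub>2 * p) (s\<^sub>2 * q) (s\<^sub>2 * r)) \<in> list_pairs"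
      show thesis
        by (rule that[OF _ L, of "diag3 1 (1 / a) (1 / b)"])
           (use b 3 in \<open>auto simp: mat_simps s23 l S_b_def\<close>)
    next
      assume L: "(S_b s\<^sub>2, diag3 (- s\<^sub>2 * p) (s\<^sub>2 * r) (s\<^sub>2 * q)) \<in> list_pairs"
      show thesis
        by (rule that[OF _ L, of "vector [vector [1, 0, 0], vector [0, 0, 1 / a], vector [0, 1 / b, 0]]"])
           (use b 3 in \<open>auto simp: mat_simps s23 l S_b_def\<close>)
    qed
  next
    case 4
    have b: "b \<noteq> 0"
      using 4 orth[of "vector [1, 0, 0]" s\<^sub>1 l\<^sub>1 "vector [1, 0, 0]" s\<^sub>1 l\<^sub>1] by (auto simp: simps)
    have s12: "s\<^sub>1 = - s\<^sub>3" "s\<^sub>2 = - s\<^sub>3"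
      using ac 4 b by auto
    have qr: "q \<noteq> r" and pr: "p \<noteq> r"
      using ST23 ST13 4 b l_nz distinct by auto
    have pq: "p \<noteq> q"
    proof
      assume "p = q"
      \<comment> \<open>The mirror image of the preceding case: \<open>[c, - b, 0]\<close> cancels
        the entries of the last column and is a common left eigenvector, whose pairing with the
        first basis vector is \<open>c\<close>.\<close>
      then have "c = 0"
        using orth[of "vector [1, 0, 0]" s\<^sub>1 l\<^sub>1 "vector [c, - b, 0]" s\<^sub>1 l\<^sub>1] 4
        by (simp add: simps s12 l mult_ac)
      then show False
        using 4 by simp
    qed
    note L = list_pairs_a_I[OF sgn(3) cubes pq qr pr]
    from L show thesis
    proof
      assume L: "(S_a s\<^sub>3, diag3 (- s\<^sub>3 * p) (- s\<^sub>3 * q) (s\<^sub>3 * r)) \<in> list_pairs"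
      show thesis
        by (rule that[OF _ L, of "diag3 b c 1"])
           (use b 4 in \<open>auto simp: mat_simps s12 l S_a_def\<close>)
    next
      assume L: "(S_a s\<^sub>3, diag3 (- s\<^sub>3 * q) (- s\<^sub>3 * p) (s\<^sub>3 * r)) \<in> list_pairs"
      show thesis
        by (rule that[OF _ L, of "vector [vector [0, b, 0], vector [c, 0, 0], vector [0, 0, 1]]"])
           (use b 4 in \<open>auto simp: mat_simps s12 l S_a_def\<close>)
    qed
  qed
qed

section \<open>Conjugate representations\<close>

lemma zero_vector_matrix: "0 v* (A :: 'a::semiring_1^'n^'m) = 0"
  by (simp add: vector_matrix_mult_def zero_vec_def)

lemma matrix_inv_matrix_inv:
  fixes P :: "'a::field^'n^'n"
  assumes "invertible P"
  shows "matrix_inv (matrix_inv P) = P"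
proof -
  have "matrix_inv (matrix_inv P) = (P ** matrix_inv P) ** matrix_inv (matrix_inv P)"
    by (simp add: matrix_inv_mult[OF assms])
  also have "\<dots> = P"
    by (simp add: matrix_inv_mult[OF invertible_matrix_inv[OF assms]] flip: matrix_mul_assoc)
  finally show ?thesis .
qed

text \<open>The columns of \<open>P\<close> are the new basis, which matches the form
  \<open>A ** P = P ** D\<close> of the eigenbasis lemmas; relative to \<open>equivalent\<close> the
  roles of \<open>P\<close> and its inverse are exchanged.\<close>

definition conjugate_rep :: "complex^'n^'n \<Rightarrow> 'n::finite rep \<Rightarrow> 'n rep" where
  "conjugate_rep P \<rho> = (\<lambda>\<gamma>. matrix_inv P ** \<rho> \<gamma> ** P)"

lemma conjugate_rep_eqI:
  assumes "invertible P" "\<rho> \<gamma> ** P = P ** A"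
  shows "conjugate_rep P \<rho> \<gamma> = A"
  using assms by (simp add: conjugate_rep_def matrix_inv_mult matrix_mul_assoc flip: matrix_mul_assoc[of _ "\<rho> \<gamma>"])

lemma mult_conjugate_rep:
  assumes "invertible P"
  shows "P ** conjugate_rep P \<rho> \<gamma> = \<rho> \<gamma> ** P"
  using assms by (simp add: conjugate_rep_def matrix_inv_mult matrix_mul_assoc)

lemma matrix_rep_conjugate_rep:
  assumes "matrix_rep \<rho>" and P: "invertible P"
  shows "matrix_rep (conjugate_rep P \<rho>)" "equivalent \<rho> (conjugate_rep P \<rho>)"
    "intertwines \<rho> (matrix_inv P) (conjugate_rep P \<rho>)"
proof -
  have "conjugate_rep P \<rho> (\<gamma> \<otimes>\<^bsub>PSL2Z\<^esub> \<delta>) = conjugate_rep P \<rho> \<gamma> ** conjugate_rep P \<rho> \<delta>"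
    if "\<gamma> \<in> carrier PSL2Z" "\<delta> \<in> carrier PSL2Z" for \<gamma> \<delta>
  proof (rule conjugate_rep_eqI[OF P])
    show "\<rho> (\<gamma> \<otimes>\<^bsub>PSL2Z\<^esub> \<delta>) ** P = P ** (conjugate_rep P \<rho> \<gamma> ** conjugate_rep P \<rho> \<delta>)"
      by (metis that assms(1) matrix_rep_mult mult_conjugate_rep[OF P] matrix_mul_assoc)
  qed
  then show "matrix_rep (conjugate_rep P \<rho>)"
    using matrix_rep_invertible[OF assms(1)] invertible_matrix_inv[OF P] P
    by (auto simp: matrix_rep_def hom_def GL_def conjugate_rep_def intro!: invertible_mult)
  show "equivalent \<rho> (conjugate_rep P \<rho>)"
    unfolding equivalent_def conjugate_rep_def
    using invertible_matrix_inv[OF P] matrix_inv_matrix_inv[OF P] by metis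
  show "intertwines \<rho> (matrix_inv P) (conjugate_rep P \<rho>)"
    by (simp add: intertwines_def conjugate_rep_def matrix_inv_mult[OF P] flip: matrix_mul_assoc)
qed

lemma conjugate_rep_left_eigenvector:
  assumes P: "invertible P"
  shows "\<phi> v* conjugate_rep P \<rho> \<gamma> = k *s \<phi> \<longleftrightarrow>
    (\<phi> v* matrix_inv P) v* \<rho> \<gamma> = k *s (\<phi> v* matrix_inv P)"
proof -
  have "\<phi> v* conjugate_rep P \<rho> \<gamma> = k *s \<phi> \<longleftrightarrow>
      (\<phi> v* conjugate_rep P \<rho> \<gamma>) v* matrix_inv P = (k *s \<phi>) v* matrix_inv P"
    using matrix_inv_mult(2)[OF P] by (metis vector_matrix_mul_assoc vector_matrix_mul_rid)
  then show ?thesis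
    by (simp add: conjugate_rep_def scale_vector_matrix vector_matrix_mul_assoc matrix_inv_mult[OF P]
        flip: matrix_mul_assoc)
qed

text \<open>The pullback of \<open>\<psi>\<close> along \<open>M\<close> is a common left
  eigenvector of \<rho>, and its kernel is the subspace sought. \<open>M\<close> may be rectangular,
  so that the lemma serves for the quotient map as well as for changes of basis.\<close>

lemma left_eigenvector_pullback:
  assumes M: "intertwines \<rho> M \<rho>'" and rep: "matrix_rep (\<rho> :: 'n::finite rep)"
    and \<psi>: "\<psi> v* \<rho>' S\<^sub>\<Gamma> = k *s \<psi>" "\<psi> v* \<rho>' T\<^sub>\<Gamma> = l *s \<psi>" "\<psi> v* M \<noteq> 0"
  shows "\<exists>W. invariant_subspace \<rho> W \<and> Suc (vec.dim W) = CARD('n)"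
proof -
  have "(\<psi> v* M) v* \<rho> S\<^sub>\<Gamma> = k *s (\<psi> v* M)" "(\<psi> v* M) v* \<rho> T\<^sub>\<Gamma> = l *s (\<psi> v* M)"
    using M S_T_in_PSL2Z \<psi>
    by (auto simp: intertwines_def vector_matrix_mul_assoc simp flip: scale_vector_matrix)
       (metis vector_matrix_mul_assoc)+
  then show ?thesis
    using common_left_eigenvector_invariant_kernel[OF rep] dim_kernel[OF \<psi>(3)] by blast
qed

lemma first_column:
  fixes A :: "complex^3^3"
  assumes "A *v axis 1 1 = k *s axis 1 1"
  shows "A $ 1 $ 1 = k" "A $ 2 $ 1 = 0" "A $ 3 $ 1 = 0"
  using assms by (auto simp: vec_eq_iff forall_3 matrix_vector_mult_def sum_3 axis_def)

text \<open>In a basis adapted to the flag, \<open>v\<close> clears the first column below the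
  diagonal and \<open>\<phi>\<close> clears the last row. Orthogonality of common eigenvectors is
  preserved by conjugation, so \<open>upper_triangular_in_list\<close> applies to
  \<open>\<tau>\<close>.\<close>

lemma flag_equivalent_to_list:
  fixes \<rho> :: "3 rep"
  assumes rep: "matrix_rep \<rho>" and ind: "indecomposable \<rho>" and diag: "diagonalizable (\<rho> T\<^sub>\<Gamma>)"
    and v: "v \<noteq> 0" "\<rho> S\<^sub>\<Gamma> *v v = k *s v" "\<rho> T\<^sub>\<Gamma> *v v = l *s v"
    and \<phi>: "\<phi> \<noteq> 0" "\<phi> v* \<rho> S\<^sub>\<Gamma> = k' *s \<phi>" "\<phi> v* \<rho> T\<^sub>\<Gamma> = l' *s \<phi>"
  shows "\<exists>\<rho>'\<in>list_L. equivalent \<rho> \<rho>'"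
proof -
  note orth = indecomposable_eigenvectors_orthogonal[OF rep ind]
  have "scalar_product \<phi> v = 0"
    by (rule orth[OF _ v(2,3) \<phi>(2,3)]) simp
  then obtain P l\<^sub>1 l\<^sub>2 l\<^sub>3 f where P: "invertible P"
    and T: "\<rho> T\<^sub>\<Gamma> ** P = P ** diag3 l\<^sub>1 l\<^sub>2 l\<^sub>3"
    and Pv: "P *v axis 1 1 = v" and P\<phi>: "\<phi> v* P = vector [0, 0, f]"
    using adapted_flag_eigenbasis[OF diag v(3,1) \<phi>(3)] by blast
  define \<tau> where "\<tau> = conjugate_rep P \<rho>"
  have rep_\<tau>: "matrix_rep \<tau>"
    unfolding \<tau>_def using matrix_rep_conjugate_rep rep P by blast
  have \<tau>T: "\<tau> T\<^sub>\<Gamma> = diag3 l\<^sub>1 l\<^sub>2 l\<^sub>3"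
    unfolding \<tau>_def using conjugate_rep_eqI[OF P] T by blast
  have P_\<tau>: "P *v (\<tau> \<gamma> *v w) = \<rho> \<gamma> *v (P *v w)" for \<gamma> w
    using mult_conjugate_rep[OF P, of \<rho> \<gamma>] by (simp add: \<tau>_def matrix_vector_mul_assoc)
  have inv_P: "matrix_inv P *v (P *v w) = w" for w
    by (simp add: matrix_vector_mul_assoc matrix_inv_mult[OF P])
  have \<phi>P: "\<phi> v* P v* matrix_inv P = \<phi>"
    by (simp add: vector_matrix_mul_assoc matrix_inv_mult[OF P])
  have "f \<noteq> 0"
  proof
    assume "f = 0"
    then have "\<phi> v* P = 0"
      by (simp add: P\<phi> vec_eq_iff forall_3)
    then show False
      using \<phi>P \<phi>(1) by (simp add: zero_vector_matrix)
  qed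
  have "\<tau> S\<^sub>\<Gamma> *v axis 1 1 = matrix_inv P *v (k *s v)"
    using P_\<tau>[of "S\<^sub>\<Gamma>" "axis 1 1"] by (metis Pv v(2) inv_P)
  also have "\<dots> = k *s axis 1 1"
    by (simp add: vec.scale inv_P flip: Pv)
  finally have col: "\<tau> S\<^sub>\<Gamma> $ 2 $ 1 = 0" "\<tau> S\<^sub>\<Gamma> $ 3 $ 1 = 0"
    using first_column by blast+
  have "\<phi> v* P v* \<tau> S\<^sub>\<Gamma> = k' *s (\<phi> v* P)"
    using \<phi>(2) by (simp add: \<tau>_def conjugate_rep_left_eigenvector[OF P] \<phi>P)
  then have row: "\<tau> S\<^sub>\<Gamma> $ 3 $ 2 = 0"
    using \<open>f \<noteq> 0\<close> unfolding P\<phi> by (auto simp: vec_eq_iff forall_3 vector_matrix_mult_def sum_3)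
  have "\<tau> S\<^sub>\<Gamma> = vector [vector [\<tau> S\<^sub>\<Gamma> $ 1 $ 1, \<tau> S\<^sub>\<Gamma> $ 1 $ 2, \<tau> S\<^sub>\<Gamma> $ 1 $ 3],
      vector [0, \<tau> S\<^sub>\<Gamma> $ 2 $ 2, \<tau> S\<^sub>\<Gamma> $ 2 $ 3], vector [0, 0, \<tau> S\<^sub>\<Gamma> $ 3 $ 3]]"
    using col row by (simp add: mat3_eq_iff)
  moreover have "scalar_product \<psi> w = 0"
    if "\<tau> S\<^sub>\<Gamma> *v w = c *s w" "\<tau> T\<^sub>\<Gamma> *v w = d *s w" "\<psi> v* \<tau> S\<^sub>\<Gamma> = c' *s \<psi>" "\<psi> v* \<tau> T\<^sub>\<Gamma> = d' *s \<psi>"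
    for \<psi> w c d c' d'
  proof -
    have "scalar_product (\<psi> v* matrix_inv P) (P *v w) = 0"
    proof (rule orth)
      show "\<rho> S\<^sub>\<Gamma> *v (P *v w) = c *s (P *v w)" "\<rho> T\<^sub>\<Gamma> *v (P *v w) = d *s (P *v w)"
        by (simp_all add: that(1,2) vec.scale flip: P_\<tau>)
      show "\<psi> v* matrix_inv P v* \<rho> S\<^sub>\<Gamma> = c' *s (\<psi> v* matrix_inv P)"
        "\<psi> v* matrix_inv P v* \<rho> T\<^sub>\<Gamma> = d' *s (\<psi> v* matrix_inv P)"
        using that(3,4) unfolding \<tau>_def conjugate_rep_left_eigenvector[OF P] .
    qed simp
    then show ?thesis
      by (simp add: scalar_product_vector_matrix inv_P)
  qed
  ultimately obtain R S' T' where R: "invertible R" "(S', T') \<in> list_pairs"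
      "\<tau> S\<^sub>\<Gamma> ** R = R ** S'" "\<tau> T\<^sub>\<Gamma> ** R = R ** T'"
    using upper_triangular_in_list[OF _ \<tau>T matrix_rep_relations[OF rep_\<tau>]] by metis
  have PR: "invertible (P ** R)"
    using P R(1) by (rule invertible_mult)
  have "\<rho> S\<^sub>\<Gamma> ** (P ** R) = (P ** R) ** S'" "\<rho> T\<^sub>\<Gamma> ** (P ** R) = (P ** R) ** T'"
    using R(3,4) mult_conjugate_rep[OF P] unfolding \<tau>_def by (metis matrix_mul_assoc)+
  then have "conjugate_rep (P ** R) \<rho> S\<^sub>\<Gamma> = S'" "conjugate_rep (P ** R) \<rho> T\<^sub>\<Gamma> = T'"
    using conjugate_rep_eqI[OF PR] by blast+
  then have "conjugate_rep (P ** R) \<rho> \<in> list_L"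
    using matrix_rep_conjugate_rep[OF rep PR] R(2) by (simp add: list_L_def)
  then show ?thesis
    using matrix_rep_conjugate_rep[OF rep PR] by blast
qed

text \<open>All matrices in the list are upper triangular, so the third coordinate is a common left
  eigenvector; it is pulled back along the equivalence.\<close>

lemma list_rep_invariant_plane:
  fixes \<rho> :: "3 rep"
  assumes rep: "matrix_rep \<rho>" and "\<rho>' \<in> list_L" "equivalent \<rho> \<rho>'"
  shows "\<exists>W. invariant_subspace \<rho> W \<and> vec.dim W = 2"
proof -
  obtain P where P: "invertible P" "\<And>\<gamma>. \<gamma> \<in> carrier PSL2Z \<Longrightarrow> \<rho>' \<gamma> = P ** \<rho> \<gamma> ** matrix_inv P"
    using assms(3) unfolding equivalent_def by blast
  have M: "intertwines \<rho> P \<rho>'"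
    by (simp add: intertwines_def P matrix_inv_mult flip: matrix_mul_assoc)
  let ?\<psi> = "vector [0, 0, 1] :: complex^3"
  have "(\<rho>' S\<^sub>\<Gamma>, \<rho>' T\<^sub>\<Gamma>) \<in> list_pairs"
    using assms(2) by (simp add: list_L_def)
  then obtain k l where \<psi>: "?\<psi> v* \<rho>' S\<^sub>\<Gamma> = k *s ?\<psi>" "?\<psi> v* \<rho>' T\<^sub>\<Gamma> = l *s ?\<psi>"
    unfolding list_pairs_def
    by (auto simp: S_a_def S_b_def S_c_def diag3_def vec_eq_iff forall_3 vector_matrix_mult_def sum_3)
  have "?\<psi> v* P \<noteq> 0"
  proof
    assume "?\<psi> v* P = 0"
    then have "?\<psi> v* P v* matrix_inv P = 0"
      by (simp add: zero_vector_matrix)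
    then have "?\<psi> = 0"
      by (simp add: vector_matrix_mul_assoc matrix_inv_mult[OF P(1)])
    then show False
      by (simp add: vec_eq_iff forall_3)
  qed
  then show ?thesis
    using left_eigenvector_pullback[OF M rep \<psi>] by simp
qed

section \<open>Eigenbases of duals and quotients\<close>

text \<open>Inverting and transposing a diagonalization replaces the eigenbasis by its dual basis
  and the eigenvalues by their inverses. Here \<open>D'\<close> is the inverse of \<open>D\<close>.
  The dimension is left open to cover both \<rho> and its quotient.\<close>

lemma dual_eigenbasis:
  fixes \<rho> :: "'n::finite rep" and P :: "complex^'n^'n"
  assumes rep: "matrix_rep \<rho>" and "\<gamma> \<in> carrier PSL2Z"
    and P: "invertible P" "\<rho> \<gamma> ** P = P ** D" and D: "D ** D' = mat 1" "transpose D' = D'"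
  shows "dual \<rho> \<gamma> ** matrix_inv (transpose P) = matrix_inv (transpose P) ** D'"
proof -
  let ?K = "matrix_inv (transpose P)"
  note K = matrix_inv_mult[OF invertible_transpose[OF P(1)]]
  have "\<rho> (inv\<^bsub>PSL2Z\<^esub> \<gamma>) ** P = \<rho> (inv\<^bsub>PSL2Z\<^esub> \<gamma>) ** (P ** D) ** D'"
    by (simp add: D flip: matrix_mul_assoc)
  also have "\<dots> = P ** D'"
    unfolding P(2)[symmetric] by (simp add: matrix_mul_assoc matrix_rep_inv[OF assms(1,2)])
  finally have "transpose P ** dual \<rho> \<gamma> = D' ** transpose P"
    by (metis D(2) dual_def matrix_transpose_mul)
  then have "?K ** (transpose P ** dual \<rho> \<gamma>) ** ?K = ?K ** (D' ** transpose P) ** ?K"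
    by simp
  then show ?thesis
    by (simp add: matrix_mul_assoc K) (simp add: K flip: matrix_mul_assoc)
qed

lemma eigenvalues_diagonalized:
  fixes B K :: "complex^2^2"
  assumes K: "invertible K" and BK: "B ** K = K ** vector [vector [a, 0], vector [0, b]]"
  shows "{x. eigenvalue B x} = {a, b}"
proof -
  have K_inv: "matrix_inv K *v (K *v u) = u" "K *v (matrix_inv K *v u) = u" for u
    by (simp_all add: matrix_vector_mul_assoc matrix_inv_mult[OF K])
  have K_eq: "K *v u = K *v w \<longleftrightarrow> u = w" for u w
    using K_inv(1) by metis
  have conj: "B *v (K *v u) = x *s (K *v u) \<longleftrightarrow> a * u $ 1 = x * u $ 1 \<and> b * u $ 2 = x * u $ 2"
    for u :: "complex^2" and x
  proof -
    have "B *v (K *v u) = x *s (K *v u) \<longleftrightarrow>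
        K *v (vector [vector [a, 0], vector [0, b]] *v u) = K *v (x *s u)"
      by (simp add: matrix_vector_mul_assoc BK vec.scale)
    also have "\<dots> \<longleftrightarrow> vector [vector [a, 0], vector [0, b]] *v u = x *s u"
      by (rule K_eq)
    finally show ?thesis
      by (simp add: vec_eq_iff forall_2 matrix_vector_mult_def sum_2)
  qed
  have nz: "K *v u = 0 \<longleftrightarrow> u = 0" for u
    using K_eq[of u 0] by simp
  have "eigenvalue B x \<longleftrightarrow> (\<exists>u. u \<noteq> 0 \<and> B *v (K *v u) = x *s (K *v u))" for x
    unfolding eigenvalue_def using nz K_inv(2) by metis
  then have *: "eigenvalue B x \<longleftrightarrow> (\<exists>u::complex^2. u \<noteq> 0 \<and> a * u $ 1 = x * u $ 1 \<and> b * u $ 2 = x * u $ 2)" for x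
    unfolding conj .
  have "eigenvalue B a" "eigenvalue B b"
    unfolding * by (rule exI[of _ "axis 1 1"], simp add: axis_def vec_eq_iff)
      (rule exI[of _ "axis 2 1"], simp add: axis_def vec_eq_iff)
  moreover have "x = a \<or> x = b" if "eigenvalue B x" for x
    using that unfolding * by (auto simp: vec_eq_iff forall_2)
  ultimately show ?thesis
    by blast
qed

text \<open>\<open>E\<close> includes the last two coordinates, so the columns of \<open>M\<close>
  are the images under \<open>Q\<close> of the last two eigenvectors. \<open>Q\<close> kills the
  first one, hence these images span the quotient.\<close>

lemma quotient_eigenbasis:
  fixes \<rho> :: "3 rep" and \<rho>\<^sub>1 :: "2 rep"
  assumes Q: "intertwines \<rho> Q \<rho>\<^sub>1" "surj ((*v) Q)" "Q *v (P *v axis 1 1) = 0"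
    and P: "invertible P" "\<rho> T\<^sub>\<Gamma> ** P = P ** diag3 l\<^sub>1 l\<^sub>2 l\<^sub>3"
  obtains M :: "complex^2^2" where "invertible M" "\<rho>\<^sub>1 T\<^sub>\<Gamma> ** M = M ** vector [vector [l\<^sub>2, 0], vector [0, l\<^sub>3]]"
proof -
  define E :: "complex^2^3" where "E = vector [vector [0, 0], vector [1, 0], vector [0, 1]]"
  define M where "M = Q ** P ** E"
  have "\<rho>\<^sub>1 T\<^sub>\<Gamma> ** M = Q ** P ** (diag3 l\<^sub>1 l\<^sub>2 l\<^sub>3 ** E)"
    using Q(1) S_T_in_PSL2Z P(2) unfolding M_def intertwines_def by (metis matrix_mul_assoc)
  also have "diag3 l\<^sub>1 l\<^sub>2 l\<^sub>3 ** E = E ** vector [vector [l\<^sub>2, 0], vector [0, l\<^sub>3]]"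
    by (simp add: diag3_def E_def vec_eq_iff forall_2 forall_3 matrix_matrix_mult_def sum_2 sum_3)
  finally have "\<rho>\<^sub>1 T\<^sub>\<Gamma> ** M = M ** vector [vector [l\<^sub>2, 0], vector [0, l\<^sub>3]]"
    by (simp add: M_def matrix_mul_assoc)
  moreover have "y \<in> range ((*v) M)" for y
  proof -
    obtain w where w: "Q *v w = y"
      using Q(2) by (metis surjD)
    define u where "u = matrix_inv P *v w"
    have "u = u $ 1 *s axis 1 1 + E *v vector [u $ 2, u $ 3]"
      by (simp add: E_def vec_eq_iff forall_3 matrix_vector_mult_def sum_2 axis_def)
    then have "Q *v (P *v u) = Q *v (P *v (u $ 1 *s axis 1 1 + E *v vector [u $ 2, u $ 3]))"
      by (rule arg_cong[where f = "\<lambda>u. Q *v (P *v u)"])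
    also have "\<dots> = u $ 1 *s (Q *v (P *v axis 1 1)) + M *v vector [u $ 2, u $ 3]"
      by (simp add: vec.add vec.scale M_def flip: matrix_vector_mul_assoc)
    finally have "Q *v (P *v u) = M *v vector [u $ 2, u $ 3]"
      by (simp add: Q(3))
    moreover have "Q *v (P *v u) = y"
      using w by (simp add: u_def matrix_vector_mul_assoc matrix_inv_mult[OF P(1)] flip: matrix_mul_assoc)
    ultimately show ?thesis
      by auto
  qed
  then have "invertible M"
    unfolding invertible_right_inverse matrix_right_invertible_surjective by blast
  ultimately show thesis
    using that by blast
qed

section \<open>Representations without an invariant plane\<close>

text \<open>If \<open>\<beta>\<close> or \<open>\<gamma>\<close> is zero, a coordinate functional
  works. Otherwise \<open>\<delta> = - \<alpha>\<close>. For \<open>l = m\<close> or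
  \<open>l = - m\<close> the eigenspace of \<open>T\<close> leaves one free parameter, which is
  solved for; in the remaining case the relations force \<open>x = y = 0\<close>.\<close>

lemma traceless_common_left_eigenvector:
  fixes S T :: "complex^3^3"
  assumes S: "S = vector [vector [s, x, y], vector [0, \<alpha>, \<beta>], vector [0, \<gamma>, \<delta>]]"
    and T: "T = diag3 l m (- m)"
    and SS: "S ** S = mat 1" and ST: "(S ** T) ** (S ** T) ** (S ** T) = mat 1"
  obtains \<phi> k k' where "\<phi> \<noteq> 0" "\<phi> v* S = k *s \<phi>" "\<phi> v* T = k' *s \<phi>"
proof -
  note simps = vec_eq_iff forall_3 vector_matrix_mult_def sum_3 S T diag3_def
  have s: "s * s = 1" and x: "s * x + x * \<alpha> + y * \<gamma> = 0" and y: "s * y + x * \<beta> + y * \<delta> = 0"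
    and \<alpha>\<beta>: "\<alpha> * \<alpha> + \<beta> * \<gamma> = 1" "\<alpha> * \<beta> + \<beta> * \<delta> = 0"
    using SS by (simp_all add: S mat3_eq_iff matrix_matrix_mult_def sum_3 mat_def)
  consider "\<beta> = 0" | "\<gamma> = 0" | "\<beta> \<noteq> 0" "\<gamma> \<noteq> 0" "l = m" | "\<beta> \<noteq> 0" "\<gamma> \<noteq> 0" "l = - m"
    | "\<beta> \<noteq> 0" "l \<noteq> m" "l \<noteq> - m"
    by blast
  then show thesis
  proof cases
    case 1
    then show thesis
      by (intro that[of "vector [0, 1, 0]" \<alpha> m]) (simp_all add: simps)
  next
    case 2
    then show thesis
      by (intro that[of "vector [0, 0, 1]" \<delta> "- m"]) (simp_all add: simps)
  next
    case 3
    have "\<delta> = - \<alpha>"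
      using 3 \<alpha>\<beta>(2) by (metis add_eq_0_iff mult.commute mult_cancel_left mult_minus_right)
    \<comment> \<open>The parameter \<open>- y / \<beta>\<close> is chosen to make the third entry
      of the image vanish; the second entry then fits by the relation \<open>y\<close>.\<close>
    then have "x + (- y / \<beta>) * \<alpha> = s * (- y / \<beta>)"
      using y 3 by (simp add: field_simps) algebra
    then show thesis
      using 3 by (intro that[of "vector [1, - y / \<beta>, 0]" s l]) (simp_all add: simps mult_ac)
  next
    case 4
    have "\<delta> = - \<alpha>"
      using 4 \<alpha>\<beta>(2) by (metis add_eq_0_iff mult.commute mult_cancel_left mult_minus_right)
    then have "y + (- x / \<gamma>) * \<delta> = s * (- x / \<gamma>)"
      using x 4 by (simp add: field_simps) algebra
    then show thesis
      using 4 by (intro that[of "vector [1, 0, - x / \<gamma>]" s l]) (simp_all add: simps mult_ac)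
  next
    case 5
    have \<delta>: "\<delta> = - \<alpha>"
      using 5 \<alpha>\<beta>(2) by (metis add_eq_0_iff mult.commute mult_cancel_left mult_minus_right)
    define g where "g = \<alpha> * m"
    define r where "r = s * l"
    \<comment> \<open>the cube root of unity that is not an eigenvalue of the lower block of \<open>ST\<close>\<close>
    define k where "k = - 2 * g"
    \<comment> \<open>\<open>X\<close> and \<open>Y\<close> form the row u =
      \<open>[x * m, - y * m]\<close> times the lower block B of \<open>S ** T\<close>.\<close>
    define X where "X = x * m * g - y * m * \<gamma> * m"
    define Y where "Y = - (x * m * \<beta> * m) - y * m * g"
    have N: "S ** T = vector [vector [r, x * m, - y * m], vector [0, g, - \<beta> * m], vector [0, \<gamma> * m, g]]"
      by (simp add: S T \<delta> diag3_def mat3_eq_iff matrix_matrix_mult_def sum_3 g_def r_def)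
    have \<beta>\<gamma>: "\<beta> * \<gamma> * m * m = m * m - g * g"
      using \<alpha>\<beta>(1) unfolding g_def by algebra
    have r: "r ^ 3 = 1"
      and g: "g ^ 3 - 3 * g * (\<beta> * \<gamma> * m * m) = 1"
      and m: "\<beta> * m * (3 * g * g - \<beta> * \<gamma> * m * m) = 0"
      and XY: "r * r * (x * m) + r * X + ((x * m) * (g * g - \<beta> * \<gamma> * m * m) - y * m * (2 * g * \<gamma> * m)) = 0"
        "- (r * r * (y * m)) + r * Y + (- (x * m * (2 * g * \<beta> * m)) - (y * m) * (g * g - \<beta> * \<gamma> * m * m)) = 0"
      using ST unfolding N
      by (auto simp: mat3_eq_iff matrix_matrix_mult_def sum_3 mat_def X_def Y_def power3_eq_cube algebra_simps)
    have "m \<noteq> 0"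
      using g by (auto simp: g_def)
    \<comment> \<open>The off-diagonal entry of the cube of B vanishes. B has trace
      \<open>2 * g = - k\<close> and determinant \<open>m * m\<close>, so this equation makes the
      determinant equal to \<open>k * k\<close>.\<close>
    then have "4 * (g * g) = m * m"
      using m 5(1) \<beta>\<gamma> by auto
    then have k: "k * k = m * m" "k ^ 3 = 1"
      using g unfolding \<beta>\<gamma> k_def by algebra+
    have "r * r = l * l"
      using s unfolding r_def by algebra
    moreover have "l * l \<noteq> m * m"
      using 5 by (simp add: square_eq_iff)
    ultimately have "r \<noteq> k"
      using k by auto
    \<comment> \<open>Since B^2 + k B + k^2 = 0, the vanishing top row r^2 u + r u B + u B^2 of the
      cube factors as (r - k) (u B + (r + k) u).\<close>
    have "(r - k) * (X + (r + k) * (x * m)) = 0" "(r - k) * (Y - (r + k) * (y * m)) = 0"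
      using XY \<beta>\<gamma> k unfolding X_def Y_def k_def by algebra+
    then have XY: "X + (r + k) * (x * m) = 0" "Y - (r + k) * (y * m) = 0"
      using \<open>r \<noteq> k\<close> by auto
    \<comment> \<open>Here the first row of \<open>S ** S = mat 1\<close> eliminates the other
      unknown.\<close>
    have "m * m * s * x * (l + m) = 0"
      using XY(1) x unfolding X_def k_def g_def r_def by algebra
    moreover have "m * m * s * y * (l - m) = 0"
      using XY(2) y unfolding Y_def k_def g_def r_def \<delta> by algebra
    moreover have "l + m \<noteq> 0" "s \<noteq> 0"
      using 5 s by (auto simp: add_eq_0_iff2)
    ultimately have "x = 0" "y = 0"
      using 5 \<open>m \<noteq> 0\<close> by auto
    then show thesis
      by (intro that[of "vector [1, 0, 0]" s l]) (simp_all add: simps)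
  qed
qed

text \<open>A proper nonzero invariant subspace of the quotient is a line, which in dimension two is
  also a hyperplane. It is cut out by a common left eigenvector, whose pullback along
  \<open>Q\<close> would cut out an invariant plane.\<close>

lemma no_plane_quotient_irreducible:
  fixes \<rho> :: "3 rep" and \<rho>\<^sub>1 :: "2 rep"
  assumes rep: "matrix_rep \<rho>" and Q: "intertwines \<rho> Q \<rho>\<^sub>1" "surj ((*v) Q)"
    and no_plane: "\<not> (\<exists>W. invariant_subspace \<rho> W \<and> vec.dim W = 2)"
  shows "irreducible_rep \<rho>\<^sub>1"
  unfolding irreducible_rep_def
proof (intro allI impI, rule ccontr)
  fix X assume X: "invariant_subspace \<rho>\<^sub>1 X" and nontriv: "\<not> (X = {0} \<or> X = UNIV)"
  have sub: "vec.subspace X"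
    using X by (simp add: invariant_subspace_def)
  have "vec.dim X \<noteq> 0"
    using nontriv vec.subspace_0[OF sub] by (auto simp: vec.dim_eq_0)
  moreover have "vec.dim X < 2"
  proof (rule ccontr)
    assume "\<not> vec.dim X < 2"
    then have "vec.dim (UNIV :: (complex^2) set) \<le> vec.dim X"
      unfolding vec_dim_card by simp
    then have "X = UNIV"
      by (intro vec.subspace_dim_equal sub vec.subspace_UNIV) auto
    then show False
      using nontriv by blast
  qed
  ultimately have "vec.dim X = 1"
    by linarith
  then have "Suc (vec.dim X) = CARD(2)"
    by simp
  then obtain \<psi> where \<psi>: "\<psi> \<noteq> 0" "\<And>\<gamma>. \<gamma> \<in> carrier PSL2Z \<Longrightarrow> \<exists>c. \<psi> v* \<rho>\<^sub>1 \<gamma> = c *s \<psi>"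
    using invariant_hyperplane_common_left_eigenvector[OF X] by metis
  obtain y where y: "scalar_product \<psi> y = 1"
    using functional_nonzero[OF \<psi>(1)] .
  obtain w where "Q *v w = y"
    using Q(2) by (metis surjD)
  then have "scalar_product (\<psi> v* Q) w = 1"
    using y by (simp add: scalar_product_vector_matrix)
  then have "\<psi> v* Q \<noteq> 0"
    by (auto simp: scalar_product_def)
  moreover obtain k l where "\<psi> v* \<rho>\<^sub>1 S\<^sub>\<Gamma> = k *s \<psi>" "\<psi> v* \<rho>\<^sub>1 T\<^sub>\<Gamma> = l *s \<psi>"
    using \<psi>(2) S_T_in_PSL2Z by blast
  ultimately show False
    using left_eigenvector_pullback[OF Q(1) rep] no_plane by auto
qed

text \<open>\<open>l\<^sub>2\<close> and \<open>l\<^sub>3\<close> are the eigenvalues on the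
  quotient by the line of \<open>v\<close>. If they were opposite,
  \<open>traceless_common_left_eigenvector\<close> in the eigenbasis would yield an invariant
  plane.\<close>

lemma no_plane_eigenvalue_ratio:
  fixes \<rho> :: "3 rep"
  assumes rep: "matrix_rep \<rho>" and v: "\<rho> S\<^sub>\<Gamma> *v v = k *s v"
    and P: "invertible P" "\<rho> T\<^sub>\<Gamma> ** P = P ** diag3 l\<^sub>1 l\<^sub>2 l\<^sub>3" "P *v axis 1 1 = v"
    and no_plane: "\<not> (\<exists>W. invariant_subspace \<rho> W \<and> vec.dim W = 2)"
  shows "l\<^sub>3 \<noteq> - l\<^sub>2"
proof
  assume l: "l\<^sub>3 = - l\<^sub>2"
  define \<tau> where "\<tau> = conjugate_rep P \<rho>"
  have rep_\<tau>: "matrix_rep \<tau>" and M: "intertwines \<rho> (matrix_inv P) \<tau>"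
    unfolding \<tau>_def using matrix_rep_conjugate_rep rep P by blast+
  have T: "\<tau> T\<^sub>\<Gamma> = diag3 l\<^sub>1 l\<^sub>2 (- l\<^sub>2)"
    unfolding \<tau>_def using conjugate_rep_eqI[OF P(1)] P(2) l by blast
  have "\<tau> S\<^sub>\<Gamma> *v axis 1 1 = matrix_inv P *v (\<rho> S\<^sub>\<Gamma> *v v)"
    by (simp add: \<tau>_def conjugate_rep_def P(3) flip: matrix_vector_mul_assoc)
  also have "\<dots> = k *s (matrix_inv P *v (P *v axis 1 1))"
    by (simp add: v vec.scale P(3))
  also have "\<dots> = k *s axis 1 1"
    by (simp add: matrix_vector_mul_assoc matrix_inv_mult[OF P(1)])
  finally have "\<tau> S\<^sub>\<Gamma> $ 2 $ 1 = 0" "\<tau> S\<^sub>\<Gamma> $ 3 $ 1 = 0"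
    using first_column by blast+
  then have "\<tau> S\<^sub>\<Gamma> = vector [vector [\<tau> S\<^sub>\<Gamma> $ 1 $ 1, \<tau> S\<^sub>\<Gamma> $ 1 $ 2, \<tau> S\<^sub>\<Gamma> $ 1 $ 3],
      vector [0, \<tau> S\<^sub>\<Gamma> $ 2 $ 2, \<tau> S\<^sub>\<Gamma> $ 2 $ 3], vector [0, \<tau> S\<^sub>\<Gamma> $ 3 $ 2, \<tau> S\<^sub>\<Gamma> $ 3 $ 3]]"
    by (simp add: mat3_eq_iff)
  then obtain \<phi> c c' where \<phi>: "\<phi> \<noteq> 0" "\<phi> v* \<tau> S\<^sub>\<Gamma> = c *s \<phi>" "\<phi> v* \<tau> T\<^sub>\<Gamma> = c' *s \<phi>"
    using traceless_common_left_eigenvector[OF _ T matrix_rep_relations[OF rep_\<tau>]] by metis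
  have "\<phi> v* matrix_inv P v* P = \<phi>"
    by (simp add: vector_matrix_mul_assoc matrix_inv_mult[OF P(1)])
  then have "\<phi> v* matrix_inv P \<noteq> 0"
    using \<phi>(1) zero_vector_matrix by metis
  then show False
    using left_eigenvector_pullback[OF M rep \<phi>(2,3)] no_plane by auto
qed

theorem theorem1p2:
  fixes \<rho> :: "3 rep" and \<rho>\<^sub>0 :: "1 rep" and \<rho>\<^sub>1 :: "2 rep"
    and J :: "complex^1^3" and Q :: "complex^3^2"
  assumes "matrix_rep \<rho>"
    and "indecomposable \<rho>"
    and "diagonalizable (\<rho> T\<^sub>\<Gamma>)"
    and "short_exact \<rho>\<^sub>0 J \<rho> Q \<rho>\<^sub>1"
  shows "((\<exists>\<rho>'\<in>list_L. equivalent \<rho> \<rho>') \<longleftrightarrow>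
            (\<exists>W. invariant_subspace \<rho> W \<and> vec.dim W = 2)) \<and>
         (\<not> (\<exists>W. invariant_subspace \<rho> W \<and> vec.dim W = 2) \<longrightarrow>
            irreducible_rep \<rho>\<^sub>1 \<and>
            (\<exists>\<rho>' :: 3 rep.
               matrix_rep \<rho>' \<and> indecomposable \<rho>' \<and> diagonalizable (\<rho>' T\<^sub>\<Gamma>) \<and>
               (\<exists>(\<rho>\<^sub>0' :: 2 rep) (J' :: complex^2^3).
                  subrepresentation_via \<rho>\<^sub>0' J' \<rho>' \<and> irreducible_rep \<rho>\<^sub>0' \<and>
                  (\<exists>\<mu> \<nu>. {x. eigenvalue (\<rho>\<^sub>0' T\<^sub>\<Gamma>) x} = {\<mu>, \<nu>} \<and> \<mu> / \<nu> \<noteq> -1)) \<and>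
               equivalent \<rho> (dual \<rho>')))"
proof -
  have rep_1: "matrix_rep \<rho>\<^sub>1" and J: "intertwines \<rho>\<^sub>0 J \<rho>" "inj ((*v) J)"
    and Q: "intertwines \<rho> Q \<rho>\<^sub>1" "surj ((*v) Q)" and ker: "range ((*v) J) = {v. Q *v v = 0}"
    using assms(4) unfolding short_exact_def subrepresentation_via_def by blast+
  define v where "v = J *v axis 1 1"
  have "v \<noteq> 0"
  proof
    assume "v = 0"
    then have "J *v axis 1 1 = J *v 0"
      by (simp add: v_def)
    then have "axis 1 1 = (0 :: complex^1)"
      by (rule injD[OF J(2)])
    then show False
      by simp
  qed
  have "\<rho> \<gamma> *v v = \<rho>\<^sub>0 \<gamma> $ 1 $ 1 *s v" if "\<gamma> \<in> carrier PSL2Z" for \<gamma>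
  proof -
    have "\<rho> \<gamma> *v v = J *v (\<rho>\<^sub>0 \<gamma> *v axis 1 1)"
      using J(1) that by (simp add: v_def intertwines_def matrix_vector_mul_assoc)
    also have "\<rho>\<^sub>0 \<gamma> *v axis 1 1 = \<rho>\<^sub>0 \<gamma> $ 1 $ 1 *s axis 1 1"
      by (simp add: vec_eq_iff forall_1 matrix_vector_mult_def sum_1 axis_def)
    finally show ?thesis
      by (simp add: v_def vec.scale)
  qed
  then obtain k l where v: "\<rho> S\<^sub>\<Gamma> *v v = k *s v" "\<rho> T\<^sub>\<Gamma> *v v = l *s v"
    using S_T_in_PSL2Z by blast
  have Qv: "Q *v v = 0"
    using ker by (auto simp: v_def)
  have "\<exists>\<rho>'\<in>list_L. equivalent \<rho> \<rho>'" if W: "invariant_subspace \<rho> W" "vec.dim W = 2" for W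
  proof -
    have "Suc (vec.dim W) = CARD(3)"
      using W by simp
    then obtain \<phi> where "\<phi> \<noteq> 0" "\<And>\<gamma>. \<gamma> \<in> carrier PSL2Z \<Longrightarrow> \<exists>c. \<phi> v* \<rho> \<gamma> = c *s \<phi>"
      using invariant_hyperplane_common_left_eigenvector[OF W(1)] by metis
    then show ?thesis
      using flag_equivalent_to_list[OF assms(1-3) \<open>v \<noteq> 0\<close> v] S_T_in_PSL2Z by metis
  qed
  then have plane_iff: "(\<exists>\<rho>'\<in>list_L. equivalent \<rho> \<rho>') \<longleftrightarrow>
      (\<exists>W. invariant_subspace \<rho> W \<and> vec.dim W = 2)"
    using list_rep_invariant_plane[OF assms(1)] by metis
  moreover have "irreducible_rep \<rho>\<^sub>1 \<and>
            (\<exists>\<rho>' :: 3 rep.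
               matrix_rep \<rho>' \<and> indecomposable \<rho>' \<and> diagonalizable (\<rho>' T\<^sub>\<Gamma>) \<and>
               (\<exists>(\<rho>\<^sub>0' :: 2 rep) (J' :: complex^2^3).
                  subrepresentation_via \<rho>\<^sub>0' J' \<rho>' \<and> irreducible_rep \<rho>\<^sub>0' \<and>
                  (\<exists>\<mu> \<nu>. {x. eigenvalue (\<rho>\<^sub>0' T\<^sub>\<Gamma>) x} = {\<mu>, \<nu>} \<and> \<mu> / \<nu> \<noteq> -1)) \<and>
               equivalent \<rho> (dual \<rho>'))"
    if no_plane: "\<not> (\<exists>W. invariant_subspace \<rho> W \<and> vec.dim W = 2)"
  proof -
    obtain P l\<^sub>1 l\<^sub>2 l\<^sub>3 where P: "invertible P" "\<rho> T\<^sub>\<Gamma> ** P = P ** diag3 l\<^sub>1 l\<^sub>2 l\<^sub>3" "P *v axis 1 1 = v"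
      using adapted_eigenbasis[OF assms(3) v(2) \<open>v \<noteq> 0\<close>] .
    \<comment> \<open>The eigenvalues must be nonzero for their inverses to be the eigenvalues of
      the dual.\<close>
    have "det (\<rho> T\<^sub>\<Gamma>) * det P = det P * det (diag3 l\<^sub>1 l\<^sub>2 l\<^sub>3)"
      using P(2) by (metis det_mul)
    moreover have "det P \<noteq> 0" "det (\<rho> T\<^sub>\<Gamma>) \<noteq> 0"
      using P(1) matrix_rep_invertible[OF assms(1) S_T_in_PSL2Z(2)] by (simp_all add: invertible_det_nz)
    ultimately have "det (diag3 l\<^sub>1 l\<^sub>2 l\<^sub>3) \<noteq> 0"
      by auto
    then have l: "l\<^sub>1 \<noteq> 0" "l\<^sub>2 \<noteq> 0" "l\<^sub>3 \<noteq> 0"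
      by (auto simp: det_3 diag3_def)
    \<comment> \<open>The witnesses are \<open>dual \<rho>\<close>, its subrepresentation
      \<open>dual \<rho>\<^sub>1\<close> embedded by \<open>transpose Q\<close>, and the eigenvalues
      \<open>1 / l\<^sub>2\<close> and \<open>1 / l\<^sub>3\<close>.\<close>
    show ?thesis
    proof (intro conjI exI)
      show irr: "irreducible_rep \<rho>\<^sub>1"
        using no_plane_quotient_irreducible[OF assms(1) Q no_plane] .
      show "matrix_rep (dual \<rho>)" "indecomposable (dual \<rho>)" "irreducible_rep (dual \<rho>\<^sub>1)"
        using matrix_rep_dual indecomposable_dual irreducible_dual assms irr by blast+
      let ?K = "matrix_inv (transpose P)" and ?D = "diag3 (1 / l\<^sub>1) (1 / l\<^sub>2) (1 / l\<^sub>3)"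
      have K: "invertible ?K"
        using P(1) by (intro invertible_matrix_inv invertible_transpose)
      have "dual \<rho> T\<^sub>\<Gamma> ** ?K = ?K ** ?D"
        by (rule dual_eigenbasis[OF assms(1) S_T_in_PSL2Z(2) P(1,2)])
           (use l in \<open>simp_all add: mat3_eq_iff diag3_def matrix_matrix_mult_def sum_3 mat_def transpose_def\<close>)
      then have "dual \<rho> T\<^sub>\<Gamma> = ?K ** ?D ** matrix_inv ?K"
        by (metis matrix_inv_mult(1)[OF K] matrix_mul_assoc matrix_mul_rid)
      moreover have "?D $ i $ j = 0" if "i \<noteq> j" for i j
        using that exhaust_3[of i] exhaust_3[of j] by (auto simp: diag3_def)
      ultimately show "diagonalizable (dual \<rho> T\<^sub>\<Gamma>)"
        using K unfolding diagonalizable_def by blast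
      show "subrepresentation_via (dual \<rho>\<^sub>1) (transpose Q) (dual \<rho>)"
        unfolding subrepresentation_via_def
      proof (intro conjI injI)
        show "matrix_rep (dual \<rho>\<^sub>1)" "matrix_rep (dual \<rho>)"
          using matrix_rep_dual assms(1) rep_1 by blast+
        show "intertwines (dual \<rho>\<^sub>1) (transpose Q) (dual \<rho>)"
          using intertwines_dual[OF Q(1)] .
        \<comment> \<open>A right inverse of the surjective \<open>Q\<close> transposes to a left
          inverse of \<open>transpose Q\<close>.\<close>
        obtain R where R: "Q ** R = mat 1"
          using Q(2) matrix_right_invertible_surjective by blast
        fix x y assume "transpose Q *v x = transpose Q *v y"
        then have "x v* Q v* R = y v* Q v* R"
          by simp
        then show "x = y"
          by (simp add: vector_matrix_mul_assoc R)
      qed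
      obtain M :: "complex^2^2" where M: "invertible M" "\<rho>\<^sub>1 T\<^sub>\<Gamma> ** M = M ** vector [vector [l\<^sub>2, 0], vector [0, l\<^sub>3]]"
        using quotient_eigenbasis[OF Q _ P(1,2)] Qv P(3) by metis
      have "dual \<rho>\<^sub>1 T\<^sub>\<Gamma> ** matrix_inv (transpose M) =
          matrix_inv (transpose M) ** vector [vector [1 / l\<^sub>2, 0], vector [0, 1 / l\<^sub>3]]"
        by (rule dual_eigenbasis[OF rep_1 S_T_in_PSL2Z(2) M])
           (use l in \<open>simp_all add: mat2_eq_iff matrix_matrix_mult_def sum_2 mat_def transpose_def\<close>)
      then show "{x. eigenvalue (dual \<rho>\<^sub>1 T\<^sub>\<Gamma>) x} = {1 / l\<^sub>2, 1 / l\<^sub>3}"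
        using eigenvalues_diagonalized invertible_matrix_inv invertible_transpose M(1) by blast
      show "1 / l\<^sub>2 / (1 / l\<^sub>3) \<noteq> - 1"
        using no_plane_eigenvalue_ratio[OF assms(1) v(1) P no_plane] l by (simp add: field_simps)
      \<comment> \<open>The double dual agrees with \<rho> on the carrier, so the identity matrix
        gives the equivalence.\<close>
      show "equivalent \<rho> (dual (dual \<rho>))"
      proof -
        have "invertible (mat 1 :: complex^3^3)"
          by (simp add: invertible_det_nz)
        then show ?thesis
          using matrix_inv_mult(1)[of "mat 1 :: complex^3^3"]
          by (auto simp: equivalent_def dual_dual intro: exI[of _ "mat 1"])
      qed
    qed
  qed
  ultimately show ?thesis
    by blast
qed

end
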